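(* (1) For any $\delta,\varepsilon\in\mathbb{R}$ and any $\{0,1\}$-valued $b\times v$ matrix $\mathbf{X}$ with $b>v>1$, let $$\mathbf{\Phi}=\begin{bmatrix}\mathbf{1}&\delta\mathbf{J}+\varepsilon\mathbf{X}^{\mathrm T}\end{bmatrix}$$ (a $v\times(b+1)$ matrix). There exists a choice of $\delta,\varepsilon\in\mathbb{R}$ such that the columns $\{\varphi_j\}_{j=1}^{b+1}$ of $\mathbf{\Phi}$ form an ETF for $\mathbb{R}^v$ with $\langle\varphi_1,\varphi_j\rangle>0$ for all $j$ if and only if $\mathbf{X}$ is the incidence matrix of a $\mathrm{QSD}(v,k,\lambda,r,b,x,y)$ with $0<k<v$ whose parameters satisfy $$w=\Bigl[\tfrac{v(b+1-v)}{b}\Bigr]^{\frac12},\quad r=\tfrac{bk}{v},\quad \lambda=\tfrac{r(k-1)}{v-1},\quad x=k-\tfrac{(v+w)(r-\lambda)}{b+1},\quad y=k-\tfrac{(v-w)(r-\lambda)}{b+1}.$$ Specifically, there are two choices for $(\delta,\varepsilon)$ here: $$\delta=\tfrac1v\Bigl[w\pm k\bigl(\tfrac{b+1}{r-\lambda}\bigr)^{\frac12}\Bigr],\qquad \varepsilon=\tfrac1k(w-\delta v)=\mp\bigl(\tfrac{b+1}{r-\lambda}\bigr)^{\frac12}.$$ (2) In particular, let $n-1>d>1$ and let $\mathbf{\Phi}$ be any $\{\pm1\}$-valued $d\times n$ matrix whose rows and columns have been signed (multiplied by $\pm1$, which can be done without loss of generality) so that $\mathbf{\Phi}=\begin{bmatrix}\mathbf{1}&\mathbf{J}-2\mathbf{X}^{\mathrm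 T}\end{bmatrix}$ where $\mathbf{X}$ is $\{0,1\}$-valued and its columns $\{\varphi_j\}_{j=1}^n$ satisfy $\langle\varphi_1,\varphi_j\rangle\ge0$ for all $j$. Then the columns of $\mathbf{\Phi}$ form an ETF for $\mathbb{R}^d$ if and only if $\mathbf{X}$ is the incidence matrix of a $\mathrm{QSD}(v,k,\lambda,r,b,x,y)$ with $v=d$, $b=n-1$, and $k=\frac{v-w}{2}$, where $$w=\Bigl[\tfrac{v(b+1-v)}{b}\Bigr]^{\frac12},\quad r=\tfrac{bk}{v},\quad \lambda=\tfrac{r(k-1)}{v-1},\quad x=\tfrac{v-3w}{4},\quad y=\tfrac{v-w}{4}.$$ In this case, $d$ and $w$ are necessarily even (integers), and $n$ is necessarily divisible by $4$.
   Context: A sequence of vectors $\{\varphi_j\}_{j=1}^n$ in $\mathbb{R}^d$ with synthesis operator $\mathbf\Phi$ (the $d\times n$ matrix whose $j$th column is $\varphi_j$) is an equiangular tight frame (ETF) for $\mathbb{R}^d$ if there exist $\beta>0$, $\gamma\ge0$, $\alpha>0$ such that $\|\varphi_j\|^2=\beta$ for all $j$, $|\langle\varphi_j,\varphi_{j'}\rangle|=\gamma$ for all $j\ne j'$, and $\mathbf{\Phi}\mathbf{\Phi}^{\mathrm T}=\alpha\mathbf{I}$. $\mathbf 1$ and $\mathbf J$ denote an all-ones column vector and an all-ones matrix of appropriate size. Given integers $v>k>0$, $b>0$, $\lambda$, $r$, a $\mathrm{BIBD}(v,k,\lambda,r,b)$ is a set of $v$ vertices together with $b$ subsets of it (blocks)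 such that each block contains exactly $k$ vertices, each vertex is in exactly $r$ blocks, and every pair of distinct vertices is in exactly $\lambda$ blocks. Its incidence matrix is the $b\times v$ $\{0,1\}$-valued matrix with rows indexed by blocks and columns by vertices. A $\mathrm{QSD}(v,k,\lambda,r,b,x,y)$ (quasi-symmetric design with block intersection numbers $y>x\ge0$) is a $\mathrm{BIBD}(v,k,\lambda,r,b)$ with $b>v$ such that the cardinality of the intersection of any two distinct blocks (i.e. blocks with distinct indices) is either $x$ or $y$; equivalently, its incidence matrix $\mathbf X$ satisfies $\mathbf X\mathbf X^{\mathrm T}=(k-x)\mathbf I+(y-x)\mathbf A+x\mathbf J$ for some $\{0,1\}$-valued matrix $\mathbf A$ that is the adjacency matrix of a graph on the blocks. *)

theory Defs
  imports Complex_Main "Jordan_Normal_Form.Matrix"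
begin

text \<open>Finite sequences of vectors are functions on the indices \<open>0, \<dots>, n - 1\<close>, so the
  first vector \<open>\<phi>\<^sub>1\<close> of a sequence is \<open>\<phi> 0\<close>.\<close>

definition synthesis_mat :: "nat \<Rightarrow> nat \<Rightarrow> (nat \<Rightarrow> real vec) \<Rightarrow> real mat" where
  "synthesis_mat d n \<phi> = mat_of_cols d (map \<phi> [0..<n])"

definition equiangular_tight_frame :: "nat \<Rightarrow> nat \<Rightarrow> (nat \<Rightarrow> real vec) \<Rightarrow> bool" where
  "equiangular_tight_frame d n \<phi> \<longleftrightarrow>
     (\<forall>j<n. \<phi> j \<in> carrier_vec d) \<and>
     (\<exists>\<beta> \<gamma> \<alpha>. \<beta> > 0 \<and> \<gamma> \<ge> 0 \<and> \<alpha> > 0 \<and>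
        (\<forall>j<n. \<phi> j \<bullet> \<phi> j = \<beta>) \<and>
        (\<forall>j<n. \<forall>j'<n. j \<noteq> j' \<longrightarrow> \<bar>\<phi> j \<bullet> \<phi> j'\<bar> = \<gamma>) \<and>
        synthesis_mat d n \<phi> * (synthesis_mat d n \<phi>)\<^sup>T = \<alpha> \<cdot>\<^sub>m 1\<^sub>m d)"

definition ones_vec :: "nat \<Rightarrow> real vec" where
  "ones_vec m = vec m (\<lambda>_. 1)"

definition ones_mat :: "nat \<Rightarrow> nat \<Rightarrow> real mat" where
  "ones_mat m n = mat m n (\<lambda>_. 1)"

text \<open>The \<open>v \<times> (b + 1)\<close> matrix \<open>[1  \<delta>J + \<epsilon>X\<^sup>T]\<close> for a \<open>b \<times> v\<close> matrix \<open>X\<close>.\<close>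

definition frame_mat :: "nat \<Rightarrow> nat \<Rightarrow> real \<Rightarrow> real \<Rightarrow> real mat \<Rightarrow> real mat" where
  "frame_mat v b \<delta> \<epsilon> X =
     mat_of_cols v (ones_vec v # cols (\<delta> \<cdot>\<^sub>m ones_mat v b + \<epsilon> \<cdot>\<^sub>m X\<^sup>T))"

text \<open>The blocks form a list, so that distinct blocks are blocks with distinct indices.\<close>

definition BIBD :: "'p set \<Rightarrow> 'p set list \<Rightarrow> nat \<Rightarrow> nat \<Rightarrow> nat \<Rightarrow> nat \<Rightarrow> nat \<Rightarrow> bool" where
  "BIBD V Bs v k lam r b \<longleftrightarrow>
     0 < k \<and> k < v \<and> 0 < b \<and>
     finite V \<and> card V = v \<and> length Bs = b \<and>
     (\<forall>i<b. Bs ! i \<subseteq> V \<and> card (Bs ! i) = k) \<and>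
     (\<forall>p\<in>V. card {i. i < b \<and> p \<in> Bs ! i} = r) \<and>
     (\<forall>p\<in>V. \<forall>q\<in>V. p \<noteq> q \<longrightarrow> card {i. i < b \<and> p \<in> Bs ! i \<and> q \<in> Bs ! i} = lam)"

definition QSD ::
  "'p set \<Rightarrow> 'p set list \<Rightarrow> nat \<Rightarrow> nat \<Rightarrow> nat \<Rightarrow> nat \<Rightarrow> nat \<Rightarrow> nat \<Rightarrow> nat \<Rightarrow> bool" where
  "QSD V Bs v k lam r b x y \<longleftrightarrow>
     BIBD V Bs v k lam r b \<and> v < b \<and> x < y \<and>
     (\<forall>i<b. \<forall>j<b. i \<noteq> j \<longrightarrow>
        card (Bs ! i \<inter> Bs ! j) = x \<or> card (Bs ! i \<inter> Bs ! j) = y)"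

definition incidence_mat :: "nat \<Rightarrow> nat set list \<Rightarrow> real mat" where
  "incidence_mat v Bs = mat (length Bs) v (\<lambda>(i, p). of_bool (p \<in> Bs ! i))"

text \<open>The columns of an incidence matrix are indexed by the vertices, so the vertex set may
  be taken to be the set of column indices.\<close>

definition QSD_incidence_mat ::
  "real mat \<Rightarrow> nat \<Rightarrow> nat \<Rightarrow> nat \<Rightarrow> nat \<Rightarrow> nat \<Rightarrow> nat \<Rightarrow> nat \<Rightarrow> bool" where
  "QSD_incidence_mat X v k lam r b x y \<longleftrightarrow>
     (\<exists>Bs. QSD {..<v} Bs v k lam r b x y \<and> X = incidence_mat v Bs)"

end

theory Submission
  imports Defs
begin

text \<open>Every vector has squared norm \<open>v\<close>, so the trace of the frame operator gives \<open>\<alpha> = b + 1\<close>, and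
  applying the frame operator to \<open>1\<close> gives \<open>\<gamma> = w\<close>. The frame conditions are then affine in the row
  sums, column sums and inner products of \<open>X\<close>, which makes \<open>X\<close> a design with
  \<open>\<delta> v + \<epsilon> k = w\<close> and \<open>\<epsilon>\<^sup>2 (r - \<lambda>) = b + 1\<close>. Conversely, for a design with the given block intersection
  numbers these two equations, which have exactly two solutions, imply the frame conditions.
  Part (2) is the solution \<open>(\<delta>, \<epsilon>) = (1, -2)\<close>.\<close>

section \<open>Frames bordered by the all-ones vector\<close>

text \<open>The value w is the Welch bound for b + 1 vectors in dimension v, multiplied by their
  common squared norm v. Two obstacles shape the passage from a frame to a design. The parameters of
  a design are natural numbers: k, r and \<lambda> are sums of zeros and ones, but x and y come from
  formulas, and these are known to give natural numbers only because both inner products -w and w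
  occur between vectors other than the all-ones vector. This uses 1 < v < b. Moreover, the norm
  conditions cannot be solved for the row and column sums of \<open>X\<close>: the coefficient of
  those sums is \<epsilon> (2 \<delta> + \<epsilon>), which vanishes at (1, -2), the case of the
  second claim. The row sums therefore come from the inner products with 1, and the column sums from
  the frame operator applied to 1; there the coefficients are \<epsilon> and w \<epsilon>.\<close>

definition welch :: "nat \<Rightarrow> nat \<Rightarrow> real" where
  "welch v b = sqrt (real v * (real b + 1 - real v) / real b)"

lemma welch_square:
  assumes "v < b"
  shows "real b * (welch v b)\<^sup>2 = real v * (real b + 1 - real v)"
  using assms by (simp add: welch_def)

lemma welch_pos:
  assumes "0 < v" "v < b"
  shows "0 < welch v b"
  using assms by (simp add: welch_def)

text \<open>\<open>h 0, \<dots>, h (b - 1)\<close> are the vectors that follow the all-ones vector.\<close>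

definition bordered_etf ::
  "nat \<Rightarrow> nat \<Rightarrow> (nat \<Rightarrow> nat \<Rightarrow> real) \<Rightarrow> real \<Rightarrow> real \<Rightarrow> bool" where
  "bordered_etf v b h \<gamma> \<alpha> \<longleftrightarrow> 0 \<le> \<gamma> \<and>
     (\<forall>i<b. (\<Sum>p<v. h i p * h i p) = real v) \<and>
     (\<forall>i<b. (\<Sum>p<v. h i p) = \<gamma>) \<and>
     (\<forall>i<b. \<forall>j<b. i \<noteq> j \<longrightarrow> \<bar>\<Sum>p<v. h i p * h j p\<bar> = \<gamma>) \<and>
     (\<forall>p<v. \<forall>q<v. 1 + (\<Sum>i<b. h i p * h i q) = \<alpha> * of_bool (p = q))"

lemma bordered_etf_constants:
  assumes etf: "bordered_etf v b h \<gamma> \<alpha>" and "0 < v" "v < b"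
  shows "\<alpha> = real b + 1" "\<gamma> = welch v b"
proof -
  have "real v * \<alpha> = (\<Sum>p<v. 1 + (\<Sum>i<b. h i p * h i p))"
    using etf by (simp add: bordered_etf_def)
  also have "\<dots> = real v + (\<Sum>i<b. \<Sum>p<v. h i p * h i p)"
    by (simp add: sum.distrib) (rule sum.swap)
  also have "\<dots> = real v * (real b + 1)"
    using etf by (simp add: bordered_etf_def algebra_simps)
  finally show \<alpha>: "\<alpha> = real b + 1"
    using \<open>0 < v\<close> by simp
  \<comment> \<open>The quadratic form of the frame operator at the all-ones vector: the border
    contributes v^2, every other vector the square of its entry sum.\<close>
  have "real v * \<alpha> = (\<Sum>p<v. \<Sum>q<v. 1 + (\<Sum>i<b. h i p * h i q))"
    using etf by (simp add: bordered_etf_def sum.delta flip: sum_distrib_left)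
  also have "\<dots> = real v * real v + (\<Sum>p<v. \<Sum>q<v. \<Sum>i<b. h i p * h i q)"
    by (simp add: sum.distrib)
  also have "(\<Sum>p<v. \<Sum>q<v. \<Sum>i<b. h i p * h i q) = (\<Sum>p<v. \<Sum>i<b. \<Sum>q<v. h i p * h i q)"
    by (intro sum.cong refl sum.swap)
  also have "\<dots> = (\<Sum>i<b. \<Sum>p<v. \<Sum>q<v. h i p * h i q)"
    by (rule sum.swap)
  also have "\<dots> = (\<Sum>i<b. (\<Sum>p<v. h i p) * (\<Sum>p<v. h i p))"
    by (simp add: sum_product)
  also have "\<dots> = real b * \<gamma>\<^sup>2"
    using etf by (simp add: bordered_etf_def power2_eq_square)
  finally have "real b * \<gamma>\<^sup>2 = real v * (real b + 1 - real v)"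
    using \<alpha> by (simp add: algebra_simps)
  then have "real b * \<gamma>\<^sup>2 = real b * (welch v b)\<^sup>2"
    using welch_square[OF \<open>v < b\<close>] by simp
  then have "\<gamma>\<^sup>2 = (welch v b)\<^sup>2"
    using \<open>v < b\<close> by simp
  then show "\<gamma> = welch v b"
    using etf welch_pos[OF assms(2,3)] by (simp add: bordered_etf_def)
qed

text \<open>This is entry p of the frame operator applied to 1: the border contributes v, and each
  other vector contributes \<gamma> times its own entry. The identity is linear in the column sum,
  which later makes the column sums of \<open>X\<close> constant.\<close>

lemma bordered_etf_row_sum:
  assumes etf: "bordered_etf v b h \<gamma> \<alpha>" and "p < v"
  shows "real v + \<gamma> * (\<Sum>i<b. h i p) = \<alpha>"
proof -
  have "\<alpha> = (\<Sum>q<v. 1 + (\<Sum>i<b. h i p * h i q))"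
    using etf \<open>p < v\<close> by (simp add: bordered_etf_def flip: sum_distrib_left)
  also have "\<dots> = real v + (\<Sum>q<v. \<Sum>i<b. h i p * h i q)"
    by (simp add: sum.distrib)
  also have "(\<Sum>q<v. \<Sum>i<b. h i p * h i q) = (\<Sum>i<b. \<Sum>q<v. h i p * h i q)"
    by (rule sum.swap)
  also have "\<dots> = (\<Sum>i<b. h i p * \<gamma>)"
    using etf by (simp add: bordered_etf_def flip: sum_distrib_left)
  finally show ?thesis
    by (simp add: sum_distrib_left mult.commute)
qed

text \<open>By \<open>bordered_etf_row_sum\<close>, the vector with entries
  \<open>real v + \<gamma> * (\<Sum>j<b. h j p)\<close> is \<alpha> times 1, so its inner product
  with \<open>h i\<close> is \<alpha> \<gamma>. Division by \<gamma> leaves one v from the border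
  and another v from the term j = i.\<close>

lemma bordered_etf_gram_sum:
  assumes etf: "bordered_etf v b h \<gamma> \<alpha>" and "i < b" "\<gamma> \<noteq> 0"
  shows "2 * real v + (\<Sum>j\<in>{..<b} - {i}. \<Sum>p<v. h i p * h j p) = \<alpha>"
proof -
  have "\<alpha> * \<gamma> = (\<Sum>p<v. h i p * (real v + \<gamma> * (\<Sum>j<b. h j p)))"
    using etf \<open>i < b\<close> bordered_etf_row_sum[OF etf]
    by (simp add: bordered_etf_def mult.commute flip: sum_distrib_left)
  also have "\<dots> = \<gamma> * real v + \<gamma> * (\<Sum>p<v. \<Sum>j<b. h i p * h j p)"
    using etf \<open>i < b\<close>
    by (simp add: bordered_etf_def distrib_left sum.distrib sum_distrib_left
        flip: sum_distrib_right) (simp add: mult_ac)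
  also have "(\<Sum>p<v. \<Sum>j<b. h i p * h j p) = (\<Sum>j<b. \<Sum>p<v. h i p * h j p)"
    by (rule sum.swap)
  also have "\<dots> = real v + (\<Sum>j\<in>{..<b} - {i}. \<Sum>p<v. h i p * h j p)"
    using etf \<open>i < b\<close> by (subst sum.remove[of _ i]) (auto simp: bordered_etf_def)
  finally have "\<gamma> * \<alpha> = \<gamma> * (2 * real v + (\<Sum>j\<in>{..<b} - {i}. \<Sum>p<v. h i p * h j p))"
    by (simp add: algebra_simps)
  then show ?thesis
    using \<open>\<gamma> \<noteq> 0\<close> by simp
qed

text \<open>If all off-diagonal inner products of one vector had the same sign, \<open>bordered_etf_gram_sum\<close>
  would force \<open>(b - 1) w = \<plusminus>(b + 1 - 2 v)\<close>, whose square factors as \<open>(v - 1) (b - v) = 0\<close>.\<close>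

lemma bordered_etf_both_signs:
  assumes etf: "bordered_etf v b h \<gamma> \<alpha>" and "1 < v" "v < b" and \<sigma>: "\<bar>\<sigma>\<bar> = \<gamma>"
  obtains i j where "i < b" "j < b" "i \<noteq> j" "(\<Sum>p<v. h i p * h j p) = \<sigma>"
proof -
  have w: "\<gamma> = welch v b" "0 < \<gamma>" and \<alpha>: "\<alpha> = real b + 1"
    using bordered_etf_constants[OF etf] welch_pos[of v b] assms by auto
  \<comment> \<open>The single vector \<open>h 0\<close> already meets both signs.\<close>
  have "\<exists>j<b. j \<noteq> 0 \<and> (\<Sum>p<v. h 0 p * h j p) = \<sigma>"
  proof (rule ccontr)
    assume none: "\<not> ?thesis"
    have "(\<Sum>p<v. h 0 p * h j p) = - \<sigma>" if "j \<in> {..<b} - {0}" for j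
    proof -
      have "\<bar>\<Sum>p<v. h 0 p * h j p\<bar> = \<bar>\<sigma>\<bar>"
        using etf that \<sigma> \<open>v < b\<close> by (auto simp: bordered_etf_def)
      then show ?thesis
        using none that by (auto simp: abs_eq_iff)
    qed
    then have "(\<Sum>j\<in>{..<b} - {0}. \<Sum>p<v. h 0 p * h j p) = - (real b - 1) * \<sigma>"
      using \<open>v < b\<close> by (simp add: of_nat_diff algebra_simps)
    then have "(real b - 1) * \<sigma> = 2 * real v - (real b + 1)"
      using bordered_etf_gram_sum[OF etf, of 0] w \<alpha> \<open>v < b\<close> by (simp add: algebra_simps)
    then have "(real b - 1)\<^sup>2 * \<sigma>\<^sup>2 = (2 * real v - (real b + 1))\<^sup>2"
      by (metis power_mult_distrib)
    moreover have "real b * \<sigma>\<^sup>2 = real v * (real b + 1 - real v)"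
      using welch_square[OF \<open>v < b\<close>] w \<sigma> by (metis power2_abs)
    ultimately have "(real b - 1)\<^sup>2 * (real v * (real b + 1 - real v)) =
        real b * (2 * real v - (real b + 1))\<^sup>2"
      by (metis mult.left_commute)
    \<comment> \<open>As a quadratic polynomial in v, the right-hand side vanishes at v = 1 and v =
      b, and its leading coefficient is -(b - 1)^2 - 4 b = -(b + 1)^2.\<close>
    moreover have "(real b + 1)\<^sup>2 * ((real v - 1) * (real b - real v)) =
        (real b - 1)\<^sup>2 * (real v * (real b + 1 - real v)) - real b * (2 * real v - (real b + 1))\<^sup>2"
      by (simp add: algebra_simps power2_eq_square)
    ultimately have "(real b + 1)\<^sup>2 * ((real v - 1) * (real b - real v)) = 0"
      by simp
    then show False
      using assms by auto
  qed
  then show thesis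
    using that[of 0] \<open>v < b\<close> by auto
qed

section \<open>Matrices\<close>

lemma etf_col_iff:
  assumes M: "M \<in> carrier_mat d n"
  shows "equiangular_tight_frame d n (col M) \<longleftrightarrow>
    (\<exists>\<beta> \<gamma> \<alpha>. \<beta> > 0 \<and> \<gamma> \<ge> 0 \<and> \<alpha> > 0 \<and>
      (\<forall>j<n. (\<Sum>p<d. M $$ (p, j) * M $$ (p, j)) = \<beta>) \<and>
      (\<forall>j<n. \<forall>j'<n. j \<noteq> j' \<longrightarrow> \<bar>\<Sum>p<d. M $$ (p, j) * M $$ (p, j')\<bar> = \<gamma>) \<and>
      (\<forall>p<d. \<forall>q<d. (\<Sum>j<n. M $$ (p, j) * M $$ (q, j)) = \<alpha> * of_bool (p = q)))"
proof -
  have synth: "synthesis_mat d n (col M) = M"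
    using M by (intro eq_matI) (auto simp: synthesis_mat_def mat_of_cols_index)
  have tight: "M * M\<^sup>T = \<alpha> \<cdot>\<^sub>m 1\<^sub>m d \<longleftrightarrow>
    (\<forall>p<d. \<forall>q<d. (\<Sum>j<n. M $$ (p, j) * M $$ (q, j)) = \<alpha> * of_bool (p = q))" for \<alpha>
  proof -
    have "M * M\<^sup>T = \<alpha> \<cdot>\<^sub>m 1\<^sub>m d \<longleftrightarrow>
      (\<forall>p<d. \<forall>q<d. (M * M\<^sup>T) $$ (p, q) = (\<alpha> \<cdot>\<^sub>m 1\<^sub>m d) $$ (p, q))"
      using M by (auto simp: mat_eq_iff)
    also have "\<dots> \<longleftrightarrow>
      (\<forall>p<d. \<forall>q<d. (\<Sum>j<n. M $$ (p, j) * M $$ (q, j)) = \<alpha> * of_bool (p = q))"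
      using M by (auto simp: scalar_prod_def lessThan_atLeast0 of_bool_def)
    finally show ?thesis .
  qed
  have cols: "col M j \<bullet> col M j' = (\<Sum>p<d. M $$ (p, j) * M $$ (p, j'))"
    if "j < n" "j' < n" for j j'
    using M that by (auto simp: scalar_prod_def lessThan_atLeast0)
  show ?thesis
    unfolding equiangular_tight_frame_def synth tight using M
    by (simp add: cols cong: conj_cong)
qed

text \<open>Signing multiplies by diagonal sign matrices S and T on the two sides. The Gram matrix
  is then conjugated by T, which keeps its diagonal and the absolute values off it; the frame
  operator is conjugated by S, which fixes multiples of the identity.\<close>

lemma etf_sign_mat_iff:
  assumes M: "M \<in> carrier_mat d n"
    and s: "\<forall>i<d. s i \<in> {1, -1::real}" and t: "\<forall>j<n. t j \<in> {1, -1::real}"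
  shows "equiangular_tight_frame d n (col (mat d n (\<lambda>(i, j). s i * t j * M $$ (i, j)))) \<longleftrightarrow>
    equiangular_tight_frame d n (col M)"
proof -
  define N where "N = mat d n (\<lambda>(i, j). s i * t j * M $$ (i, j))"
  have N: "N \<in> carrier_mat d n" by (simp add: N_def)
  have ss: "s i * s i = 1" if "i < d" for i using s that by auto
  have tt: "t j * t j = 1" if "j < n" for j using t that by auto
  have gram: "(\<Sum>p<d. N $$ (p, j) * N $$ (p, j')) = t j * t j' * (\<Sum>p<d. M $$ (p, j) * M $$ (p, j'))"
    if "j < n" "j' < n" for j j'
  proof -
    have "N $$ (p, j) * N $$ (p, j') = t j * t j' * (M $$ (p, j) * M $$ (p, j'))" if "p < d" for p
    proof -
      have "N $$ (p, j) * N $$ (p, j') = (s p * s p) * (t j * t j' * (M $$ (p, j) * M $$ (p, j')))"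
        using that \<open>j < n\<close> \<open>j' < n\<close> by (simp add: N_def)
      then show ?thesis using ss that by simp
    qed
    then show ?thesis by (simp add: sum_distrib_left)
  qed
  have frame: "(\<Sum>j<n. N $$ (p, j) * N $$ (q, j)) = s p * s q * (\<Sum>j<n. M $$ (p, j) * M $$ (q, j))"
    if "p < d" "q < d" for p q
  proof -
    have "N $$ (p, j) * N $$ (q, j) = s p * s q * (M $$ (p, j) * M $$ (q, j))" if "j < n" for j
    proof -
      have "N $$ (p, j) * N $$ (q, j) = (t j * t j) * (s p * s q * (M $$ (p, j) * M $$ (q, j)))"
        using that \<open>p < d\<close> \<open>q < d\<close> by (simp add: N_def)
      then show ?thesis using tt that by simp
    qed
    then show ?thesis by (simp add: sum_distrib_left)
  qed
  have abs_t: "\<bar>t j\<bar> = 1" if "j < n" for j using t that by auto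
  have sign: "s p * s q * c = \<alpha> * of_bool (p = q) \<longleftrightarrow> c = \<alpha> * of_bool (p = q)"
    if "p < d" "q < d" for p q c \<alpha>
    using s that by (cases "p = q") (auto simp: ss)
  show ?thesis
    unfolding N_def[symmetric] etf_col_iff[OF M] etf_col_iff[OF N]
    by (simp add: gram frame tt abs_t abs_mult sign cong: conj_cong)
qed

lemma frame_mat_carrier: "X \<in> carrier_mat b v \<Longrightarrow> frame_mat v b \<delta> \<epsilon> X \<in> carrier_mat v (b + 1)"
  unfolding frame_mat_def
  by (rule carrier_matI) (simp_all only: mat_of_cols_carrier list.size cols_length, simp add: ones_mat_def)

lemma frame_mat_index_0 [simp]:
  "X \<in> carrier_mat b v \<Longrightarrow> p < v \<Longrightarrow> frame_mat v b \<delta> \<epsilon> X $$ (p, 0) = 1"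
  by (simp add: frame_mat_def mat_of_cols_index ones_vec_def)

lemma frame_mat_index_Suc [simp]:
  "X \<in> carrier_mat b v \<Longrightarrow> p < v \<Longrightarrow> i < b \<Longrightarrow>
    frame_mat v b \<delta> \<epsilon> X $$ (p, Suc i) = \<delta> + \<epsilon> * X $$ (i, p)"
  by (simp add: frame_mat_def mat_of_cols_index ones_mat_def)

text \<open>Row \<open>i\<close> is the frame vector of block \<open>i\<close>, that is, column
  \<open>Suc i\<close> of \<open>frame_mat\<close>; the indices are transposed to match
  \<open>X\<close>.\<close>

definition affine_rows :: "real mat \<Rightarrow> real \<Rightarrow> real \<Rightarrow> nat \<Rightarrow> nat \<Rightarrow> real" where
  "affine_rows X \<delta> \<epsilon> i p = \<delta> + \<epsilon> * X $$ (i, p)"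

lemma all_less_Suc_shift: "(\<forall>j<Suc n. P j) \<longleftrightarrow> P 0 \<and> (\<forall>j<n. P (Suc j))"
  using All_less_Suc2 by blast

lemma frame_mat_inner_0:
  assumes X: "X \<in> carrier_mat b v" and "i < b"
  shows "col (frame_mat v b \<delta> \<epsilon> X) 0 \<bullet> col (frame_mat v b \<delta> \<epsilon> X) (Suc i) =
    (\<Sum>p<v. affine_rows X \<delta> \<epsilon> i p)"
  using assms frame_mat_carrier[OF X, of \<delta> \<epsilon>]
  by (auto simp: scalar_prod_def lessThan_atLeast0 affine_rows_def)

lemma frame_mat_inner_00:
  assumes X: "X \<in> carrier_mat b v"
  shows "col (frame_mat v b \<delta> \<epsilon> X) 0 \<bullet> col (frame_mat v b \<delta> \<epsilon> X) 0 = real v"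
  using assms frame_mat_carrier[OF X, of \<delta> \<epsilon>]
  by (auto simp: scalar_prod_def)

text \<open>The all-ones column forces the common squared norm to be v. The sign condition on the
  inner products with that column removes the absolute values there, so that the row sums themselves
  equal \<gamma>.\<close>

lemma etf_frame_mat_iff:
  assumes X: "X \<in> carrier_mat b v" and "0 < v"
  shows "equiangular_tight_frame v (b + 1) (col (frame_mat v b \<delta> \<epsilon> X)) \<and>
      (\<forall>j<b + 1. 0 \<le> col (frame_mat v b \<delta> \<epsilon> X) 0 \<bullet> col (frame_mat v b \<delta> \<epsilon> X) j) \<longleftrightarrow>
    (\<exists>\<gamma> \<alpha>. bordered_etf v b (affine_rows X \<delta> \<epsilon>) \<gamma> \<alpha>)"
proof -
  define F where "F = frame_mat v b \<delta> \<epsilon> X"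
  define h where "h = affine_rows X \<delta> \<epsilon>"
  have F: "F \<in> carrier_mat v (b + 1)" unfolding F_def using X by (rule frame_mat_carrier)
  have F0: "F $$ (p, 0) = 1" if "p < v" for p using X that by (simp add: F_def)
  have FS: "F $$ (p, Suc i) = h i p" if "p < v" "i < b" for p i
    using X that by (simp add: F_def h_def affine_rows_def)
  have nonneg: "(\<forall>j<b + 1. 0 \<le> col F 0 \<bullet> col F j) \<longleftrightarrow> (\<forall>i<b. 0 \<le> (\<Sum>p<v. h i p))"
    using frame_mat_inner_0[OF X] frame_mat_inner_00[OF X]
    by (simp add: all_less_Suc_shift F_def h_def)
  have tight: "(\<Sum>j<b + 1. F $$ (p, j) * F $$ (q, j)) = 1 + (\<Sum>i<b. h i p * h i q)"
    if "p < v" "q < v" for p q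
    using that by (simp add: sum.lessThan_Suc_shift F0 FS del: sum.lessThan_Suc)
  have F_norm: "(\<forall>j<b + 1. (\<Sum>p<v. F $$ (p, j) * F $$ (p, j)) = \<beta>) \<longleftrightarrow>
      real v = \<beta> \<and> (\<forall>i<b. (\<Sum>p<v. h i p * h i p) = \<beta>)" for \<beta>
    by (simp add: all_less_Suc_shift F0 FS)
  have F_angle: "(\<forall>j<b + 1. \<forall>j'<b + 1. j \<noteq> j' \<longrightarrow> \<bar>\<Sum>p<v. F $$ (p, j) * F $$ (p, j')\<bar> = \<gamma>) \<longleftrightarrow>
      (\<forall>i<b. \<bar>\<Sum>p<v. h i p\<bar> = \<gamma>) \<and>
      (\<forall>i<b. \<forall>j<b. i \<noteq> j \<longrightarrow> \<bar>\<Sum>p<v. h i p * h j p\<bar> = \<gamma>)" for \<gamma>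
    by (auto simp add: all_less_Suc_shift F0 FS)
  have etf: "equiangular_tight_frame v (b + 1) (col F) \<longleftrightarrow>
    (\<exists>\<gamma> \<alpha>. \<gamma> \<ge> 0 \<and> \<alpha> > 0 \<and> (\<forall>i<b. (\<Sum>p<v. h i p * h i p) = real v) \<and>
      (\<forall>i<b. \<bar>\<Sum>p<v. h i p\<bar> = \<gamma>) \<and>
      (\<forall>i<b. \<forall>j<b. i \<noteq> j \<longrightarrow> \<bar>\<Sum>p<v. h i p * h j p\<bar> = \<gamma>) \<and>
      (\<forall>p<v. \<forall>q<v. 1 + (\<Sum>i<b. h i p * h i q) = \<alpha> * of_bool (p = q)))"
  proof -
    have tight_iff: "(\<forall>p<v. \<forall>q<v. (\<Sum>j<b + 1. F $$ (p, j) * F $$ (q, j)) = \<alpha> * of_bool (p = q)) \<longleftrightarrow>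
        (\<forall>p<v. \<forall>q<v. 1 + (\<Sum>i<b. h i p * h i q) = \<alpha> * of_bool (p = q))" for \<alpha>
      by (intro all_cong) (simp only: tight)
    have "0 < real v"
      using \<open>0 < v\<close> by simp
    then show ?thesis
      unfolding etf_col_iff[OF F] F_norm F_angle tight_iff by blast
  qed
  \<comment> \<open>Positivity of \<alpha> is not stated by \<open>bordered_etf\<close>; it holds
    because a diagonal entry of the frame operator is 1 plus a sum of squares.\<close>
  have pos: "0 < \<alpha>" if "bordered_etf v b h \<gamma> \<alpha>" for \<gamma> \<alpha>
  proof -
    have "\<alpha> = 1 + (\<Sum>i<b. h i 0 * h i 0)"
      using that \<open>0 < v\<close> by (simp add: bordered_etf_def)
    moreover have "0 \<le> (\<Sum>i<b. h i 0 * h i 0)"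
      by (intro sum_nonneg) simp
    ultimately show ?thesis by linarith
  qed
  show ?thesis
    unfolding F_def[symmetric] h_def[symmetric]
  proof
    assume "equiangular_tight_frame v (b + 1) (col F) \<and> (\<forall>j<b + 1. 0 \<le> col F 0 \<bullet> col F j)"
    then obtain \<gamma> \<alpha> where E: "0 \<le> \<gamma>" "\<forall>i<b. (\<Sum>p<v. h i p * h i p) = real v"
        "\<forall>i<b. \<bar>\<Sum>p<v. h i p\<bar> = \<gamma>" "\<forall>i<b. 0 \<le> (\<Sum>p<v. h i p)"
        "\<forall>i<b. \<forall>j<b. i \<noteq> j \<longrightarrow> \<bar>\<Sum>p<v. h i p * h j p\<bar> = \<gamma>"
        "\<forall>p<v. \<forall>q<v. 1 + (\<Sum>i<b. h i p * h i q) = \<alpha> * of_bool (p = q)"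
      unfolding etf nonneg by blast
    then have "\<forall>i<b. (\<Sum>p<v. h i p) = \<gamma>"
      by (metis abs_of_nonneg)
    with E have "bordered_etf v b h \<gamma> \<alpha>"
      unfolding bordered_etf_def by blast
    then show "\<exists>\<gamma> \<alpha>. bordered_etf v b h \<gamma> \<alpha>"
      by blast
  next
    assume "\<exists>\<gamma> \<alpha>. bordered_etf v b h \<gamma> \<alpha>"
    then obtain \<gamma> \<alpha> where B: "bordered_etf v b h \<gamma> \<alpha>" by blast
    then have "\<forall>i<b. (\<Sum>p<v. h i p) = \<gamma>" "0 \<le> \<gamma>"
      unfolding bordered_etf_def by blast+
    then have "\<forall>i<b. \<bar>\<Sum>p<v. h i p\<bar> = \<gamma>" "\<forall>i<b. 0 \<le> (\<Sum>p<v. h i p)"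
      by auto
    with B show "equiangular_tight_frame v (b + 1) (col F) \<and> (\<forall>j<b + 1. 0 \<le> col F 0 \<bullet> col F j)"
      using pos[OF B] unfolding etf nonneg bordered_etf_def by blast
  qed
qed

lemma etf_frame_mat_nonneg_iff:
  assumes X: "X \<in> carrier_mat b v" and "0 < v" "v < b"
  shows "equiangular_tight_frame v (b + 1) (col (frame_mat v b \<delta> \<epsilon> X)) \<and>
      (\<forall>j<b + 1. 0 \<le> col (frame_mat v b \<delta> \<epsilon> X) 0 \<bullet> col (frame_mat v b \<delta> \<epsilon> X) j) \<longleftrightarrow>
    bordered_etf v b (affine_rows X \<delta> \<epsilon>) (welch v b) (real b + 1)"
  unfolding etf_frame_mat_iff[OF assms(1,2)] using bordered_etf_constants assms by metis

text \<open>The strict and the weak sign condition agree for these frames, because the inner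
  products with the all-ones vector are v or w, and w > 0.\<close>

lemma etf_frame_mat_pos_iff:
  assumes X: "X \<in> carrier_mat b v" and "0 < v" "v < b"
  shows "equiangular_tight_frame v (b + 1) (col (frame_mat v b \<delta> \<epsilon> X)) \<and>
      (\<forall>j<b + 1. 0 < col (frame_mat v b \<delta> \<epsilon> X) 0 \<bullet> col (frame_mat v b \<delta> \<epsilon> X) j) \<longleftrightarrow>
    bordered_etf v b (affine_rows X \<delta> \<epsilon>) (welch v b) (real b + 1)"
proof -
  have "\<forall>j<b + 1. 0 < col (frame_mat v b \<delta> \<epsilon> X) 0 \<bullet> col (frame_mat v b \<delta> \<epsilon> X) j"
    if "bordered_etf v b (affine_rows X \<delta> \<epsilon>) (welch v b) (real b + 1)"
    using that frame_mat_inner_0[OF X] frame_mat_inner_00[OF X] welch_pos[OF assms(2,3)] \<open>0 < v\<close>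
    by (simp add: all_less_Suc_shift bordered_etf_def)
  then show ?thesis
    using etf_frame_mat_nonneg_iff[OF assms, of \<delta> \<epsilon>] less_imp_le by blast
qed

section \<open>Quasi-symmetric designs\<close>

lemma Nats_sum:
  "(\<And>x. x \<in> A \<Longrightarrow> f x \<in> \<nat>) \<Longrightarrow> sum f A \<in> \<nat>"
  by (induction A rule: infinite_finite_induct) auto

lemma sum_of_bool_inter:
  "finite A \<Longrightarrow> (\<Sum>p\<in>A. of_bool (P p) * of_bool (Q p)) = real (card {p \<in> A. P p \<and> Q p})"
  by (simp add: Int_def flip: of_bool_conj)

lemma zero_one_entry:
  assumes "X \<in> carrier_mat b v" "elements_mat X \<subseteq> {0, 1::real}" "i < b" "p < v"
  shows "X $$ (i, p) = 0 \<or> X $$ (i, p) = 1"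
  using assms elements_matI[of X b v i p] by blast

text \<open>Cardinalities become sums of products of indicator values. The equivalence is shown in
  \<open>key\<close> for an arbitrary list of blocks with incidence matrix \<open>X\<close>, so it
  serves both for a given design and for the list of row supports.\<close>

lemma QSD_incidence_mat_iff:
  assumes X: "X \<in> carrier_mat b v" and X01: "elements_mat X \<subseteq> {0, 1}" and "v < b"
  shows "QSD_incidence_mat X v k lam r b x y \<longleftrightarrow>
    0 < k \<and> k < v \<and> x < y \<and>
    (\<forall>i<b. (\<Sum>p<v. X $$ (i, p)) = real k) \<and>
    (\<forall>p<v. (\<Sum>i<b. X $$ (i, p)) = real r) \<and>
    (\<forall>p<v. \<forall>q<v. p \<noteq> q \<longrightarrow> (\<Sum>i<b. X $$ (i, p) * X $$ (i, q)) = real lam) \<and>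
    (\<forall>i<b. \<forall>j<b. i \<noteq> j \<longrightarrow>
       (\<Sum>p<v. X $$ (i, p) * X $$ (j, p)) = real x \<or>
       (\<Sum>p<v. X $$ (i, p) * X $$ (j, p)) = real y)"
    (is "_ \<longleftrightarrow> ?R")
proof -
  have key: "QSD {..<v} Bs v k lam r b x y \<longleftrightarrow> ?R"
    if len: "length Bs = b" and sub: "\<forall>i<b. Bs ! i \<subseteq> {..<v}" and XB: "X = incidence_mat v Bs" for Bs
  proof -
    have ent: "X $$ (i, p) = of_bool (p \<in> Bs ! i)" if "i < b" "p < v" for i p
      using that len by (simp add: XB incidence_mat_def)
    have k: "(\<Sum>p<v. X $$ (i, p)) = real (card (Bs ! i))" if "i < b" for i
    proof -
      have "{..<v} \<inter> Bs ! i = Bs ! i" using sub that by auto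
      then show ?thesis using that by (simp add: ent)
    qed
    have r: "(\<Sum>i<b. X $$ (i, p)) = real (card {i. i < b \<and> p \<in> Bs ! i})" if "p < v" for p
      using that by (simp add: ent Int_def)
    have l: "(\<Sum>i<b. X $$ (i, p) * X $$ (i, q)) = real (card {i. i < b \<and> p \<in> Bs ! i \<and> q \<in> Bs ! i})"
      if "p < v" "q < v" for p q
      using that sum_of_bool_inter[of "{..<b}" "\<lambda>i. p \<in> Bs ! i" "\<lambda>i. q \<in> Bs ! i"] by (simp add: ent)
    have n: "(\<Sum>p<v. X $$ (i, p) * X $$ (j, p)) = real (card (Bs ! i \<inter> Bs ! j))"
      if "i < b" "j < b" for i j
    proof -
      have "{p \<in> {..<v}. p \<in> Bs ! i \<and> p \<in> Bs ! j} = Bs ! i \<inter> Bs ! j" using sub that by auto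
      then show ?thesis
        using that sum_of_bool_inter[of "{..<v}" "\<lambda>p. p \<in> Bs ! i" "\<lambda>p. p \<in> Bs ! j"] by (simp add: ent)
    qed
    show ?thesis
      using len sub \<open>v < b\<close> by (auto simp: QSD_def BIBD_def k r l n)
  qed
  define Bs0 where "Bs0 = map (\<lambda>i. {p. p < v \<and> X $$ (i, p) = 1}) [0..<b]"
  have X0: "X = incidence_mat v Bs0"
    using X zero_one_entry[OF X X01]
    by (intro eq_matI) (auto simp: incidence_mat_def Bs0_def of_bool_def)
  have len0: "length Bs0 = b" "\<forall>i<b. Bs0 ! i \<subseteq> {..<v}"
    by (auto simp: Bs0_def)
  show ?thesis
  proof
    assume ?R
    then have "QSD {..<v} Bs0 v k lam r b x y"
      unfolding key[OF len0 X0] .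
    then show "QSD_incidence_mat X v k lam r b x y"
      unfolding QSD_incidence_mat_def using X0 by blast
  next
    assume "QSD_incidence_mat X v k lam r b x y"
    then obtain Bs where Q: "QSD {..<v} Bs v k lam r b x y" and XB: "X = incidence_mat v Bs"
      unfolding QSD_incidence_mat_def by blast
    from Q have "length Bs = b" "\<forall>i<b. Bs ! i \<subseteq> {..<v}"
      by (simp_all add: QSD_def BIBD_def)
    from key[OF this XB] Q show ?R
      by (rule iffD1)
  qed
qed

section \<open>Frame conditions as affine conditions on sums over the zero-one matrix\<close>

lemma sum_affine_product:
  fixes f g :: "nat \<Rightarrow> real"
  shows "(\<Sum>p<m. (\<delta> + \<epsilon> * f p) * (\<delta> + \<epsilon> * g p)) =
    real m * \<delta>\<^sup>2 + \<delta> * \<epsilon> * ((\<Sum>p<m. f p) + (\<Sum>p<m. g p)) + \<epsilon>\<^sup>2 * (\<Sum>p<m. f p * g p)"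
proof -
  have "(\<Sum>p<m. (\<delta> + \<epsilon> * f p) * (\<delta> + \<epsilon> * g p)) =
    (\<Sum>p<m. \<delta>\<^sup>2 + \<delta> * \<epsilon> * (f p + g p) + \<epsilon>\<^sup>2 * (f p * g p))"
    by (intro sum.cong refl) (simp add: algebra_simps power2_eq_square)
  then show ?thesis
    by (simp add: sum.distrib flip: sum_distrib_left)
qed

lemma affine_rows_sum: "(\<Sum>p<v. affine_rows X \<delta> \<epsilon> i p) = real v * \<delta> + \<epsilon> * (\<Sum>p<v. X $$ (i, p))"
  by (simp add: affine_rows_def sum.distrib flip: sum_distrib_left)

lemma affine_cols_sum: "(\<Sum>i<b. affine_rows X \<delta> \<epsilon> i p) = real b * \<delta> + \<epsilon> * (\<Sum>i<b. X $$ (i, p))"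
  by (simp add: affine_rows_def sum.distrib flip: sum_distrib_left)

text \<open>The body repeats the predicate \<open>qsd\<close> of the final statement, so that it can
  be folded there.\<close>

definition etf_design ::
  "nat \<Rightarrow> nat \<Rightarrow> real mat \<Rightarrow> nat \<Rightarrow> nat \<Rightarrow> nat \<Rightarrow> nat \<Rightarrow> nat \<Rightarrow> bool" where
  "etf_design v b X k lam r x y \<longleftrightarrow>
     QSD_incidence_mat X v k lam r b x y \<and> 0 < k \<and> k < v \<and>
     real r = real b * real k / real v \<and>
     real lam = real r * (real k - 1) / (real v - 1) \<and>
     real x = real k - (real v + welch v b) * (real r - real lam) / (real b + 1) \<and>
     real y = real k - (real v - welch v b) * (real r - real lam) / (real b + 1)"

locale zero_one_mat =
  fixes X :: "real mat" and v b :: nat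
  assumes v: "1 < v" "v < b"
    and X: "X \<in> carrier_mat b v" and X01: "elements_mat X \<subseteq> {0, 1}"
begin

abbreviation "w \<equiv> welch v b"
abbreviation "is_etf \<delta> \<epsilon> \<equiv> bordered_etf v b (affine_rows X \<delta> \<epsilon>) w (real b + 1)"

lemmas QSD_iff = QSD_incidence_mat_iff[OF X X01 v(2)]

lemma w_pos: "0 < w" and w_square: "real b * w\<^sup>2 = real v * (real b + 1 - real v)"
  using welch_pos[of v b] welch_square[of v b] v by auto

text \<open>The gap is b (v^2 - w^2) = (b + 1) v (v - 1). It rules out \<epsilon> = 0 as well as
  empty and full blocks.\<close>

lemma w_less: "w < real v"
proof -
  have "real b * w\<^sup>2 < real b * (real v)\<^sup>2"
  proof -
    have "0 < (real b + 1) * (real v * (real v - 1))"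
      using v by simp
    then show ?thesis
      unfolding w_square by (simp add: algebra_simps power2_eq_square)
  qed
  then show ?thesis
    using v by (simp add: power2_less_imp_less)
qed

lemma entry: "i < b \<Longrightarrow> p < v \<Longrightarrow> X $$ (i, p) = 0 \<or> X $$ (i, p) = 1"
  using zero_one_entry[OF X X01] .

lemma entry_idem [simp]: "i < b \<Longrightarrow> p < v \<Longrightarrow> X $$ (i, p) * X $$ (i, p) = X $$ (i, p)"
  using entry by force

lemma entry_Nats: "i < b \<Longrightarrow> p < v \<Longrightarrow> X $$ (i, p) \<in> \<nat>"
  using entry by (metis Nats_0 Nats_1)

text \<open>Since the entries of \<open>X\<close> are idempotent, squared norms and diagonal entries
  of the frame operator involve only row and column sums; the diagonal and the off-diagonal of the
  frame operator are therefore listed separately.\<close>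

lemma is_etf_iff:
  "is_etf \<delta> \<epsilon> \<longleftrightarrow>
     (\<forall>i<b. real v * \<delta>\<^sup>2 + 2 * \<delta> * \<epsilon> * (\<Sum>p<v. X $$ (i, p)) + \<epsilon>\<^sup>2 * (\<Sum>p<v. X $$ (i, p)) = real v) \<and>
     (\<forall>i<b. real v * \<delta> + \<epsilon> * (\<Sum>p<v. X $$ (i, p)) = w) \<and>
     (\<forall>i<b. \<forall>j<b. i \<noteq> j \<longrightarrow>
        \<bar>real v * \<delta>\<^sup>2 + \<delta> * \<epsilon> * ((\<Sum>p<v. X $$ (i, p)) + (\<Sum>p<v. X $$ (j, p))) +
          \<epsilon>\<^sup>2 * (\<Sum>p<v. X $$ (i, p) * X $$ (j, p))\<bar> = w) \<and>
     (\<forall>p<v. 1 + (real b * \<delta>\<^sup>2 + 2 * \<delta> * \<epsilon> * (\<Sum>i<b. X $$ (i, p)) + \<epsilon>\<^sup>2 * (\<Sum>i<b. X $$ (i, p))) =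
        real b + 1) \<and>
     (\<forall>p<v. \<forall>q<v. p \<noteq> q \<longrightarrow>
        1 + (real b * \<delta>\<^sup>2 + \<delta> * \<epsilon> * ((\<Sum>i<b. X $$ (i, p)) + (\<Sum>i<b. X $$ (i, q))) +
          \<epsilon>\<^sup>2 * (\<Sum>i<b. X $$ (i, p) * X $$ (i, q))) = 0)"
proof -
  have row: "(\<Sum>p<v. affine_rows X \<delta> \<epsilon> i p * affine_rows X \<delta> \<epsilon> i p) =
      real v * \<delta>\<^sup>2 + 2 * \<delta> * \<epsilon> * (\<Sum>p<v. X $$ (i, p)) + \<epsilon>\<^sup>2 * (\<Sum>p<v. X $$ (i, p))"
    if "i < b" for i
    unfolding affine_rows_def sum_affine_product using that by simp
  have col: "(\<Sum>i<b. affine_rows X \<delta> \<epsilon> i p * affine_rows X \<delta> \<epsilon> i p) =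
      real b * \<delta>\<^sup>2 + 2 * \<delta> * \<epsilon> * (\<Sum>i<b. X $$ (i, p)) + \<epsilon>\<^sup>2 * (\<Sum>i<b. X $$ (i, p))"
    if "p < v" for p
    unfolding affine_rows_def sum_affine_product using that by simp
  have gram: "(\<Sum>p<v. affine_rows X \<delta> \<epsilon> i p * affine_rows X \<delta> \<epsilon> j p) =
      real v * \<delta>\<^sup>2 + \<delta> * \<epsilon> * ((\<Sum>p<v. X $$ (i, p)) + (\<Sum>p<v. X $$ (j, p))) +
        \<epsilon>\<^sup>2 * (\<Sum>p<v. X $$ (i, p) * X $$ (j, p))" for i j
    unfolding affine_rows_def sum_affine_product ..
  have frame: "(\<Sum>i<b. affine_rows X \<delta> \<epsilon> i p * affine_rows X \<delta> \<epsilon> i q) =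
      real b * \<delta>\<^sup>2 + \<delta> * \<epsilon> * ((\<Sum>i<b. X $$ (i, p)) + (\<Sum>i<b. X $$ (i, q))) +
        \<epsilon>\<^sup>2 * (\<Sum>i<b. X $$ (i, p) * X $$ (i, q))" for p q
    unfolding affine_rows_def sum_affine_product ..
  have diag: "(\<forall>p<v. \<forall>q<v. T p q = c * of_bool (p = q)) \<longleftrightarrow>
      (\<forall>p<v. T p p = c) \<and> (\<forall>p<v. \<forall>q<v. p \<noteq> q \<longrightarrow> T p q = 0)"
    for T :: "nat \<Rightarrow> nat \<Rightarrow> real" and c
  proof (intro iffI conjI allI impI)
    fix p q
    assume "(\<forall>p<v. T p p = c) \<and> (\<forall>p<v. \<forall>q<v. p \<noteq> q \<longrightarrow> T p q = 0)" "p < v" "q < v"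
    then show "T p q = c * of_bool (p = q)"
      by (cases "p = q") simp_all
  qed auto
  have rows: "(\<forall>i<b. (\<Sum>p<v. affine_rows X \<delta> \<epsilon> i p * affine_rows X \<delta> \<epsilon> i p) = c) \<longleftrightarrow>
      (\<forall>i<b. real v * \<delta>\<^sup>2 + 2 * \<delta> * \<epsilon> * (\<Sum>p<v. X $$ (i, p)) + \<epsilon>\<^sup>2 * (\<Sum>p<v. X $$ (i, p)) = c)" for c
    by (intro all_cong) (simp only: row)
  have cols: "(\<forall>p<v. 1 + (\<Sum>i<b. affine_rows X \<delta> \<epsilon> i p * affine_rows X \<delta> \<epsilon> i p) = c) \<longleftrightarrow>
      (\<forall>p<v. 1 + (real b * \<delta>\<^sup>2 + 2 * \<delta> * \<epsilon> * (\<Sum>i<b. X $$ (i, p)) +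
        \<epsilon>\<^sup>2 * (\<Sum>i<b. X $$ (i, p))) = c)" for c
    by (intro all_cong) (simp only: col)
  have "0 \<le> w"
    using w_pos by simp
  then show ?thesis
    unfolding bordered_etf_def diag affine_rows_sum rows cols unfolding gram frame by blast
qed

section \<open>From frames to designs\<close>

text \<open>Once \<epsilon> is nonzero, each of the sums is determined by an equation that is linear
  in it, hence does not depend on the chosen block, vertex or pair. The parameters are still real
  numbers here.\<close>

lemma is_etf_imp_parameters:
  assumes etf: "is_etf \<delta> \<epsilon>"
  obtains k r l :: real where "\<epsilon> \<noteq> 0"
    "0 < k" "k < real v" "\<And>i. i < b \<Longrightarrow> (\<Sum>p<v. X $$ (i, p)) = k"
    "\<And>p. p < v \<Longrightarrow> (\<Sum>i<b. X $$ (i, p)) = r"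
    "\<And>p q. p < v \<Longrightarrow> q < v \<Longrightarrow> p \<noteq> q \<Longrightarrow> (\<Sum>i<b. X $$ (i, p) * X $$ (i, q)) = l"
    "real v * \<delta> + \<epsilon> * k = w" "\<epsilon>\<^sup>2 * (r - l) = real b + 1"
proof -
  note E = etf[unfolded is_etf_iff]
  have norm: "real v * \<delta>\<^sup>2 + 2 * \<delta> * \<epsilon> * (\<Sum>p<v. X $$ (i, p)) + \<epsilon>\<^sup>2 * (\<Sum>p<v. X $$ (i, p)) = real v"
    and first: "real v * \<delta> + \<epsilon> * (\<Sum>p<v. X $$ (i, p)) = w" if "i < b" for i
    using E that by auto
  have diag: "1 + (real b * \<delta>\<^sup>2 + 2 * \<delta> * \<epsilon> * (\<Sum>i<b. X $$ (i, p)) + \<epsilon>\<^sup>2 * (\<Sum>i<b. X $$ (i, p))) =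
      real b + 1" if "p < v" for p
    using E that by auto
  have off: "1 + (real b * \<delta>\<^sup>2 + \<delta> * \<epsilon> * ((\<Sum>i<b. X $$ (i, p)) + (\<Sum>i<b. X $$ (i, q))) +
      \<epsilon>\<^sup>2 * (\<Sum>i<b. X $$ (i, p) * X $$ (i, q))) = 0" if "p < v" "q < v" "p \<noteq> q" for p q
    using E that by auto
  have b0: "0 < b" using v by simp
  have sq: "w\<^sup>2 \<noteq> (real v)\<^sup>2"
    using w_pos w_less by (simp add: power2_eq_iff)
  define k where "k = (\<Sum>p<v. X $$ (0, p))"
  have k_eqs: "real v * \<delta>\<^sup>2 + 2 * \<delta> * \<epsilon> * k + \<epsilon>\<^sup>2 * k = real v" "real v * \<delta> + \<epsilon> * k = w"
    using norm[OF b0] first[OF b0] by (auto simp: k_def)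
  \<comment> \<open>Elimination of \<delta>: v times the norm equation minus the square of \<delta>
    v + \<epsilon> k = w. As w < v, no factor on the left can vanish.\<close>
  have "\<epsilon>\<^sup>2 * (k * (real v - k)) = (real v)\<^sup>2 - w\<^sup>2"
  proof -
    have "real v * (real v * \<delta>\<^sup>2 + 2 * \<delta> * \<epsilon> * k + \<epsilon>\<^sup>2 * k) = (real v)\<^sup>2"
      using k_eqs(1) by (simp add: power2_eq_square)
    then show ?thesis
      unfolding k_eqs(2)[symmetric] by (simp add: algebra_simps power2_eq_square)
  qed
  then have "\<epsilon> \<noteq> 0" "k \<noteq> 0" "k \<noteq> real v"
    using sq by auto
  have "0 \<le> k"
    unfolding k_def using entry[OF b0] by (intro sum_nonneg) force
  have "k \<le> real v"
  proof -
    have "k \<le> (\<Sum>p<v. 1)"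
      unfolding k_def using entry[OF b0] by (intro sum_mono) force
    then show ?thesis by simp
  qed
  have K: "(\<Sum>p<v. X $$ (i, p)) = k" if "i < b" for i
  proof -
    have "\<epsilon> * (\<Sum>p<v. X $$ (i, p)) = \<epsilon> * k"
      using first[OF that] k_eqs(2) by linarith
    then show ?thesis
      using \<open>\<epsilon> \<noteq> 0\<close> by simp
  qed
  define r where "r = (\<Sum>i<b. X $$ (i, 0))"
  have R: "(\<Sum>i<b. X $$ (i, p)) = r" if "p < v" for p
  proof -
    \<comment> \<open>Here the column sum has the nonzero coefficient w \<epsilon>; in
      \<open>diag\<close> its coefficient \<epsilon> (2 \<delta> + \<epsilon>) may be zero.\<close>
    have "real v + w * (real b * \<delta> + \<epsilon> * (\<Sum>i<b. X $$ (i, p))) = real b + 1" if "p < v" for p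
      using bordered_etf_row_sum[OF etf that] by (simp add: affine_cols_sum)
    from this[OF that] this[of 0] have
      "w * (real b * \<delta> + \<epsilon> * (\<Sum>i<b. X $$ (i, p))) = w * (real b * \<delta> + \<epsilon> * r)"
      using v unfolding r_def by linarith
    then show ?thesis
      using w_pos \<open>\<epsilon> \<noteq> 0\<close> by simp
  qed
  define l where "l = (\<Sum>i<b. X $$ (i, 0) * X $$ (i, 1))"
  have off': "1 + (real b * \<delta>\<^sup>2 + \<delta> * \<epsilon> * (r + r) + \<epsilon>\<^sup>2 * (\<Sum>i<b. X $$ (i, p) * X $$ (i, q))) = 0"
    if "p < v" "q < v" "p \<noteq> q" for p q
    using off[OF that] that by (simp add: R)
  have off_l: "1 + (real b * \<delta>\<^sup>2 + \<delta> * \<epsilon> * (r + r) + \<epsilon>\<^sup>2 * l) = 0"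
    using off'[of 0 1] v by (simp add: l_def)
  have L: "(\<Sum>i<b. X $$ (i, p) * X $$ (i, q)) = l" if "p < v" "q < v" "p \<noteq> q" for p q
  proof -
    have "\<epsilon>\<^sup>2 * (\<Sum>i<b. X $$ (i, p) * X $$ (i, q)) = \<epsilon>\<^sup>2 * l"
      using off'[OF that] off_l by linarith
    then show ?thesis
      using \<open>\<epsilon> \<noteq> 0\<close> by simp
  qed
  \<comment> \<open>The difference of a diagonal and an off-diagonal entry of the frame operator, in
    which all terms with \<delta> cancel.\<close>
  have "\<epsilon>\<^sup>2 * (r - l) = real b + 1"
    using diag[of 0] off_l v unfolding r_def by (simp add: algebra_simps)
  then show thesis
    using that[of k r l] \<open>\<epsilon> \<noteq> 0\<close> \<open>0 \<le> k\<close> \<open>k \<noteq> 0\<close> \<open>k \<le> real v\<close> \<open>k \<noteq> real v\<close> K R L k_eqs(2)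
    by (simp add: less_le)
qed

text \<open>The two classical counts for block designs: all incidences, and the incidences that lie
  in blocks through vertex 0.\<close>

lemma double_count:
  fixes k r l :: real
  assumes K: "\<And>i. i < b \<Longrightarrow> (\<Sum>p<v. X $$ (i, p)) = k"
    and R: "\<And>p. p < v \<Longrightarrow> (\<Sum>i<b. X $$ (i, p)) = r"
    and L: "\<And>p q. p < v \<Longrightarrow> q < v \<Longrightarrow> p \<noteq> q \<Longrightarrow> (\<Sum>i<b. X $$ (i, p) * X $$ (i, q)) = l"
  shows "r = real b * k / real v" "l = r * (k - 1) / (real v - 1)"
proof -
  have "real b * k = (\<Sum>i<b. \<Sum>p<v. X $$ (i, p))"
    by (simp add: K)
  also have "\<dots> = (\<Sum>p<v. \<Sum>i<b. X $$ (i, p))"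
    by (rule sum.swap)
  also have "\<dots> = real v * r"
    by (simp add: R)
  finally show "r = real b * k / real v"
    using v by (simp add: field_simps)
  have v0: "0 < v" using v by simp
  have "k * r = (\<Sum>i<b. X $$ (i, 0) * (\<Sum>q<v. X $$ (i, q)))"
    using R[OF v0] by (simp add: K flip: sum_distrib_right)
  also have "\<dots> = (\<Sum>q<v. \<Sum>i<b. X $$ (i, 0) * X $$ (i, q))"
    unfolding sum_distrib_left by (rule sum.swap)
  also have "\<dots> = (\<Sum>i<b. X $$ (i, 0) * X $$ (i, 0)) +
      (\<Sum>q\<in>{..<v} - {0}. \<Sum>i<b. X $$ (i, 0) * X $$ (i, q))"
    using v0 by (subst sum.remove[of _ 0]) auto
  also have "\<dots> = r + (real v - 1) * l"
    using v0 R[OF v0] by (simp add: L of_nat_diff)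
  finally show "l = r * (k - 1) / (real v - 1)"
    using v by (simp add: field_simps)
qed

text \<open>Block intersection sizes are affine in the inner products of the frame vectors, and
  \<epsilon>^2 (r - \<lambda>) = b + 1 turns the slope into (r - \<lambda>) / (b + 1). The inner
  product -w yields x, and w yields y.\<close>

lemma is_etf_imp_design:
  assumes etf: "is_etf \<delta> \<epsilon>"
  shows "\<exists>k lam r x y. etf_design v b X k lam r x y"
proof -
  obtain k' r' l' :: real where "\<epsilon> \<noteq> 0" and k: "0 < k'" "k' < real v"
    and K: "\<And>i. i < b \<Longrightarrow> (\<Sum>p<v. X $$ (i, p)) = k'"
    and R: "\<And>p. p < v \<Longrightarrow> (\<Sum>i<b. X $$ (i, p)) = r'"
    and L: "\<And>p q. p < v \<Longrightarrow> q < v \<Longrightarrow> p \<noteq> q \<Longrightarrow> (\<Sum>i<b. X $$ (i, p) * X $$ (i, q)) = l'"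
    and \<delta>: "real v * \<delta> + \<epsilon> * k' = w" and \<epsilon>: "\<epsilon>\<^sup>2 * (r' - l') = real b + 1"
    using is_etf_imp_parameters[OF etf] by blast
  have v0: "0 < v" and b0: "0 < b" using v by auto
  \<comment> \<open>Each is a sum of zeros and ones, read off at block 0 and at the vertices 0 and
    1.\<close>
  have "k' \<in> \<nat>" "r' \<in> \<nat>" "l' \<in> \<nat>"
    using K[OF b0] R[OF v0] L[OF v0 v(1)] entry_Nats v0 b0 v(1)
    by (auto intro!: Nats_sum Nats_mult simp flip: K[OF b0] R[OF v0] L[OF v0 v(1)])
  then obtain k r lam :: nat where nat: "k' = real k" "r' = real r" "l' = real lam"
    by (auto simp: Nats_def)
  note K = K[unfolded nat] and R = R[unfolded nat] and L = L[unfolded nat]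
  note params = double_count[OF K R L]
  have r_l: "\<epsilon>\<^sup>2 * (real r - real lam) = real b + 1"
    using \<epsilon> nat by simp
  have norm: "real v * \<delta>\<^sup>2 + 2 * \<delta> * \<epsilon> * real k + \<epsilon>\<^sup>2 * real k = real v"
    using etf b0 unfolding is_etf_iff by (auto simp: K)
  \<comment> \<open>With constant row sums, the inner product differs from the squared norm v only
    in the term with \<epsilon>^2, where the intersection size replaces k.\<close>
  have inner: "(\<Sum>p<v. affine_rows X \<delta> \<epsilon> i p * affine_rows X \<delta> \<epsilon> j p) =
      real v - \<epsilon>\<^sup>2 * (real k - (\<Sum>p<v. X $$ (i, p) * X $$ (j, p)))" if "i < b" "j < b" for i j
    using norm that unfolding affine_rows_def sum_affine_product by (simp add: K algebra_simps)
  have val: "(\<Sum>p<v. X $$ (i, p) * X $$ (j, p)) =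
      real k - (real v - \<sigma>) * (real r - real lam) / (real b + 1)"
    if "i < b" "j < b" "(\<Sum>p<v. affine_rows X \<delta> \<epsilon> i p * affine_rows X \<delta> \<epsilon> j p) = \<sigma>" for i j \<sigma>
  proof -
    have *: "\<epsilon>\<^sup>2 * (real k - (\<Sum>p<v. X $$ (i, p) * X $$ (j, p))) = real v - \<sigma>"
      using inner[OF that(1,2)] that(3) by simp
    have "real r \<noteq> real lam"
      using r_l by auto
    then have "(real v - \<sigma>) * (real r - real lam) / (real b + 1) =
      real k - (\<Sum>p<v. X $$ (i, p) * X $$ (j, p))"
      unfolding *[symmetric] r_l[symmetric] using \<open>\<epsilon> \<noteq> 0\<close> \<open>real r \<noteq> real lam\<close> by simp
    then show ?thesis by simp
  qed
  \<comment> \<open>The formula gives a natural number because some pair of blocks realizes it as an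
    intersection size.\<close>
  have attained: "\<exists>n::nat. real n = real k - (real v - \<sigma>) * (real r - real lam) / (real b + 1)"
    if \<sigma>: "\<bar>\<sigma>\<bar> = w" for \<sigma>
  proof -
    obtain i j where ij: "i < b" "j < b"
        "(\<Sum>p<v. affine_rows X \<delta> \<epsilon> i p * affine_rows X \<delta> \<epsilon> j p) = \<sigma>"
      using bordered_etf_both_signs[OF etf v \<sigma>] by blast
    have "(\<Sum>p<v. X $$ (i, p) * X $$ (j, p)) \<in> \<nat>"
      using ij entry_Nats by (intro Nats_sum Nats_mult) auto
    then show ?thesis
      using val[OF ij] by (auto simp: Nats_def)
  qed
  obtain x :: nat where x: "real x = real k - (real v + w) * (real r - real lam) / (real b + 1)"
    using attained[of "- w"] w_pos by auto
  obtain y :: nat where y: "real y = real k - (real v - w) * (real r - real lam) / (real b + 1)"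
    using attained[of w] w_pos by auto
  have "0 < real r - real lam"
  proof (rule zero_less_mult_pos)
    show "0 < \<epsilon>\<^sup>2 * (real r - real lam)"
      unfolding r_l by linarith
  qed (simp add: \<open>\<epsilon> \<noteq> 0\<close>)
  then have "real x < real y"
    unfolding x y using w_pos by (auto intro!: divide_strict_right_mono)
  moreover have "(\<Sum>p<v. X $$ (i, p) * X $$ (j, p)) = real x \<or>
      (\<Sum>p<v. X $$ (i, p) * X $$ (j, p)) = real y" if "i < b" "j < b" "i \<noteq> j" for i j
  proof -
    have "\<bar>\<Sum>p<v. affine_rows X \<delta> \<epsilon> i p * affine_rows X \<delta> \<epsilon> j p\<bar> = w"
      using etf that by (auto simp: bordered_etf_def)
    then consider "(\<Sum>p<v. affine_rows X \<delta> \<epsilon> i p * affine_rows X \<delta> \<epsilon> j p) = - w"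
      | "(\<Sum>p<v. affine_rows X \<delta> \<epsilon> i p * affine_rows X \<delta> \<epsilon> j p) = w"
      by linarith
    then show ?thesis
      using val[OF that(1,2)] x y by cases auto
  qed
  ultimately have "QSD_incidence_mat X v k lam r b x y"
    unfolding QSD_iff using k nat K R L by auto
  then show ?thesis
    using k params x y unfolding etf_design_def nat of_nat_0_less_iff of_nat_less_iff by blast
qed

section \<open>From designs to frames\<close>

text \<open>The formula for \<open>l\<close> gives (v - 1) (r - l) = r (v - k), and multiplication
  by v replaces v r by b k. The identity shows r > \<lambda> and links the equation for \<epsilon>^2
  with the norm condition.\<close>

lemma r_minus_lam:
  fixes k r l :: real
  assumes "r = real b * k / real v" "l = r * (k - 1) / (real v - 1)"
  shows "real v * (real v - 1) * (r - l) = real b * (k * (real v - k))"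
proof -
  have r: "real v * r = real b * k" and l: "(real v - 1) * l = r * (k - 1)"
    using assms v by auto
  have "real v * (real v - 1) * (r - l) = real v * (real v - 1) * r - real v * ((real v - 1) * l)"
    by (simp add: algebra_simps power2_eq_square)
  also have "\<dots> = real v * r * (real v - k)"
    unfolding l by (simp add: algebra_simps power2_eq_square)
  finally show ?thesis
    unfolding r by simp
qed

lemma etf_design_r_minus_lam:
  assumes "etf_design v b X k lam r x y"
  shows "real v * (real v - 1) * (real r - real lam) = real b * (real k * (real v - real k))"
    and "0 < real r - real lam"
proof -
  show *: "real v * (real v - 1) * (real r - real lam) = real b * (real k * (real v - real k))"
    using assms r_minus_lam[of "real r" "real k" "real lam"] by (simp add: etf_design_def)
  have "0 < k" "k < v"
    using assms by (auto simp: etf_design_def)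
  then have "0 < real v * (real v - 1) * (real r - real lam)"
    unfolding * using v by simp
  then show "0 < real r - real lam"
    using v by (elim zero_less_mult_pos) simp
qed

text \<open>For a frame, the parameters from \<open>is_etf_imp_parameters\<close> are the same sums
  as those of the design. Conversely, the two equations, v r = b k and \<open>r_minus_lam\<close>
  recover the norms, and every other condition follows from these and the formulas for x and
  y.\<close>

lemma design_is_etf_iff:
  assumes D: "etf_design v b X k lam r x y"
  shows "is_etf \<delta> \<epsilon> \<longleftrightarrow> real v * \<delta> + \<epsilon> * real k = w \<and> \<epsilon>\<^sup>2 * (real r - real lam) = real b + 1"
    (is "_ \<longleftrightarrow> ?E")
proof
  have Q: "QSD_incidence_mat X v k lam r b x y"
    using D by (simp add: etf_design_def)
  have K: "(\<Sum>p<v. X $$ (i, p)) = real k" if "i < b" for i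
    using Q that by (simp add: QSD_iff)
  have R: "(\<Sum>i<b. X $$ (i, p)) = real r" if "p < v" for p
    using Q that by (simp add: QSD_iff)
  have L: "(\<Sum>i<b. X $$ (i, p) * X $$ (i, q)) = real lam" if "p < v" "q < v" "p \<noteq> q" for p q
    using Q that by (simp add: QSD_iff)
  have N: "(\<Sum>p<v. X $$ (i, p) * X $$ (j, p)) = real x \<or>
      (\<Sum>p<v. X $$ (i, p) * X $$ (j, p)) = real y" if "i < b" "j < b" "i \<noteq> j" for i j
    using Q that by (auto simp: QSD_iff)
  show ?E if etf: "is_etf \<delta> \<epsilon>"
  proof -
    have i: "0 < b" "0 < v" "1 < v" using v by auto
    obtain k' r' l' :: real where "\<epsilon> \<noteq> 0" "0 < k'" "k' < real v"
      and K': "\<And>i. i < b \<Longrightarrow> (\<Sum>p<v. X $$ (i, p)) = k'"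
      and R': "\<And>p. p < v \<Longrightarrow> (\<Sum>i<b. X $$ (i, p)) = r'"
      and L': "\<And>p q. p < v \<Longrightarrow> q < v \<Longrightarrow> p \<noteq> q \<Longrightarrow> (\<Sum>i<b. X $$ (i, p) * X $$ (i, q)) = l'"
      and E: "real v * \<delta> + \<epsilon> * k' = w" "\<epsilon>\<^sup>2 * (r' - l') = real b + 1"
      using is_etf_imp_parameters[OF etf] by blast
    have "k' = real k" "r' = real r" "l' = real lam"
      using K'[OF i(1)] R'[OF i(2)] L'[OF i(2,3)] K[OF i(1)] R[OF i(2)] L[OF i(2,3)] by auto
    then show ?E
      using E by simp
  qed
  assume ?E
  then have \<delta>: "real v * \<delta> + \<epsilon> * real k = w" and \<epsilon>: "\<epsilon>\<^sup>2 * (real r - real lam) = real b + 1"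
    by auto
  have v0: "real v \<noteq> 0" and b0: "real b \<noteq> 0" using v by auto
  have r: "real v * real r = real b * real k"
    using D v by (simp add: etf_design_def)
  \<comment> \<open>The elimination of \<delta> run backwards: multiplied by b v, the left side is b
    w^2 + b \<epsilon>^2 k (v - k), and the equation for \<epsilon>^2 evaluates the second
    term.\<close>
  have norm: "real v * \<delta>\<^sup>2 + 2 * \<delta> * \<epsilon> * real k + \<epsilon>\<^sup>2 * real k = real v"
  proof -
    have "real b * (real v * (real v * \<delta>\<^sup>2 + 2 * \<delta> * \<epsilon> * real k + \<epsilon>\<^sup>2 * real k)) =
      real b * w\<^sup>2 + \<epsilon>\<^sup>2 * (real b * (real k * (real v - real k)))"
      unfolding \<delta>[symmetric] by (simp add: algebra_simps power2_eq_square)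
    also have "\<epsilon>\<^sup>2 * (real b * (real k * (real v - real k))) =
      real v * (real v - 1) * (\<epsilon>\<^sup>2 * (real r - real lam))"
      unfolding etf_design_r_minus_lam(1)[OF D, symmetric] by (simp only: mult_ac)
    also have "real b * w\<^sup>2 + \<dots> = real b * (real v * real v)"
      unfolding w_square \<epsilon> by (simp add: algebra_simps power2_eq_square)
    finally show ?thesis using b0 v0 by simp
  qed
  \<comment> \<open>Since v r = b k, the column condition is b / v times the row condition.\<close>
  have diag: "real b * \<delta>\<^sup>2 + 2 * \<delta> * \<epsilon> * real r + \<epsilon>\<^sup>2 * real r = real b"
  proof -
    have "real v * (real b * \<delta>\<^sup>2 + 2 * \<delta> * \<epsilon> * real r + \<epsilon>\<^sup>2 * real r) =
      real v * real b * \<delta>\<^sup>2 + (2 * \<delta> * \<epsilon> + \<epsilon>\<^sup>2) * (real v * real r)"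
      by (simp add: algebra_simps power2_eq_square)
    also have "\<dots> = real b * (real v * \<delta>\<^sup>2 + 2 * \<delta> * \<epsilon> * real k + \<epsilon>\<^sup>2 * real k)"
      unfolding r by (simp add: algebra_simps power2_eq_square)
    finally have "real v * (real b * \<delta>\<^sup>2 + 2 * \<delta> * \<epsilon> * real r + \<epsilon>\<^sup>2 * real r) = real v * real b"
      unfolding norm by simp
    then show ?thesis using v0 by simp
  qed
  \<comment> \<open>Used with c = v + w for x and c = v - w for y; the inner product is then v - c,
    that is -w or w.\<close>
  have inner: "\<epsilon>\<^sup>2 * real z = \<epsilon>\<^sup>2 * real k - c"
    if "real z = real k - c * (real r - real lam) / (real b + 1)" for z c
  proof -
    have "\<epsilon>\<^sup>2 * (real k - real z) = c * (\<epsilon>\<^sup>2 * (real r - real lam)) / (real b + 1)"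
      using that by simp
    also have "\<dots> = c"
      unfolding \<epsilon> by (simp add: add_nonneg_eq_0_iff)
    finally show ?thesis
      by (simp add: algebra_simps)
  qed
  have inner_x: "\<epsilon>\<^sup>2 * real x = \<epsilon>\<^sup>2 * real k - (real v + w)"
    and inner_y: "\<epsilon>\<^sup>2 * real y = \<epsilon>\<^sup>2 * real k - (real v - w)"
    using D by (intro inner; simp only: etf_design_def)+
  have "\<bar>real v * \<delta>\<^sup>2 + \<delta> * \<epsilon> * (real k + real k) +
      \<epsilon>\<^sup>2 * (\<Sum>p<v. X $$ (i, p) * X $$ (j, p))\<bar> = w" if "i < b" "j < b" "i \<noteq> j" for i j
    using N[OF that]
  proof
    assume *: "(\<Sum>p<v. X $$ (i, p) * X $$ (j, p)) = real x"
    have "real v * \<delta>\<^sup>2 + \<delta> * \<epsilon> * (real k + real k) + \<epsilon>\<^sup>2 * real x = - w"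
      using norm inner_x by (simp add: algebra_simps)
    then show ?thesis
      unfolding * using w_pos by simp
  next
    assume *: "(\<Sum>p<v. X $$ (i, p) * X $$ (j, p)) = real y"
    have "real v * \<delta>\<^sup>2 + \<delta> * \<epsilon> * (real k + real k) + \<epsilon>\<^sup>2 * real y = w"
      using norm inner_y by (simp add: algebra_simps)
    then show ?thesis
      unfolding * using w_pos by simp
  qed
  moreover have "1 + (real b * \<delta>\<^sup>2 + \<delta> * \<epsilon> * (real r + real r) + \<epsilon>\<^sup>2 * real lam) = 0"
    using diag \<epsilon> by (simp add: algebra_simps)
  ultimately show "is_etf \<delta> \<epsilon>"
    unfolding is_etf_iff using norm diag \<delta> by (simp add: K R L)
qed

text \<open>The equation for \<epsilon>^2 has the roots -s and s, and the linear equation determines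
  \<delta> from each. The root -s comes first because it belongs to the plus sign in \<delta>. The
  pairs differ since r > \<lambda> makes s positive.\<close>

lemma design_etf_parameters:
  assumes D: "etf_design v b X k lam r x y"
  defines "s \<equiv> sqrt ((real b + 1) / (real r - real lam))"
  shows "{(\<delta>, \<epsilon>). is_etf \<delta> \<epsilon>} =
      {((w + real k * s) / real v, - s), ((w - real k * s) / real v, s)}"
    and "card {(\<delta>, \<epsilon>). is_etf \<delta> \<epsilon>} = 2"
    and "is_etf \<delta> \<epsilon> \<Longrightarrow> \<epsilon> = (w - \<delta> * real v) / real k"
proof -
  note rl = etf_design_r_minus_lam(2)[OF D]
  have s2: "s\<^sup>2 = (real b + 1) / (real r - real lam)" and "0 < s"
    unfolding s_def using rl by auto
  have "\<epsilon>\<^sup>2 * (real r - real lam) = real b + 1 \<longleftrightarrow> \<epsilon> = - s \<or> \<epsilon> = s" for \<epsilon>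
  proof -
    have "\<epsilon>\<^sup>2 * (real r - real lam) = real b + 1 \<longleftrightarrow> \<epsilon>\<^sup>2 = s\<^sup>2"
      unfolding s2 using rl by (simp add: eq_divide_eq)
    then show ?thesis
      by (auto simp: power2_eq_iff)
  qed
  moreover have "real v * \<delta> + \<epsilon> * real k = w \<longleftrightarrow> \<delta> = (w - real k * \<epsilon>) / real v" for \<delta> \<epsilon>
    using v by (auto simp: field_simps)
  ultimately show *: "{(\<delta>, \<epsilon>). is_etf \<delta> \<epsilon>} =
      {((w + real k * s) / real v, - s), ((w - real k * s) / real v, s)}"
    unfolding design_is_etf_iff[OF D] by auto
  show "card {(\<delta>, \<epsilon>). is_etf \<delta> \<epsilon>} = 2"
    unfolding * using \<open>0 < s\<close> by simp
  show "\<epsilon> = (w - \<delta> * real v) / real k" if "is_etf \<delta> \<epsilon>"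
  proof -
    have "real v * \<delta> + \<epsilon> * real k = w" "0 < k"
      using that D unfolding design_is_etf_iff[OF D] by (auto simp: etf_design_def)
    then show ?thesis
      by (simp add: field_simps)
  qed
qed

section \<open>Sign matrices: the solution (1, -2)\<close>

definition real_design :: "nat \<Rightarrow> nat \<Rightarrow> nat \<Rightarrow> nat \<Rightarrow> nat \<Rightarrow> bool" where
  "real_design k lam r x y \<longleftrightarrow>
     QSD_incidence_mat X v k lam r b x y \<and>
     real k = (real v - w) / 2 \<and>
     real r = real b * real k / real v \<and>
     real lam = real r * (real k - 1) / (real v - 1) \<and>
     real x = (real v - 3 * w) / 4 \<and>
     real y = (real v - w) / 4"

lemma mult_divide_quarter:
  fixes a c m :: real
  assumes "4 * a = m" "0 < m"
  shows "c * a / m = c / 4"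
proof -
  have "a \<noteq> 0"
    using assms by auto
  then show ?thesis
    unfolding assms(1)[symmetric] by simp
qed

text \<open>At (1, -2) the two equations read w = v - 2 k and 4 (r - \<lambda>) = b + 1, and the
  second turns (r - \<lambda>) / (b + 1) into 1/4 in the formulas for x and y. If only k = (v - w) /
  2 is given, then 4 k (v - k) = v^2 - w^2, and \<open>r_minus_lam\<close> yields the second
  equation.\<close>

lemma real_design_iff:
  "real_design k lam r x y \<longleftrightarrow> etf_design v b X k lam r x y \<and> is_etf 1 (-2)"
proof
  assume R: "real_design k lam r x y"
  have k: "0 < k" "k < v"
    using R by (auto simp: real_design_def QSD_iff)
  have kw: "w = real v - 2 * real k"
    using R by (simp add: real_design_def)
  have "real v * (real v - 1) * (real r - real lam) = real b * (real k * (real v - real k))"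
    using R by (intro r_minus_lam) (simp_all only: real_design_def)
  then have "real v * (real v - 1) * (4 * (real r - real lam)) =
      4 * (real b * (real k * (real v - real k)))"
    by (simp only: mult.left_commute[of _ 4])
  also have "\<dots> = real b * (real v)\<^sup>2 - real b * w\<^sup>2"
    unfolding kw by (simp add: algebra_simps power2_eq_square)
  also have "\<dots> = real v * (real v - 1) * (real b + 1)"
    unfolding w_square by (simp add: algebra_simps power2_eq_square)
  finally have "real v * (real v - 1) * (4 * (real r - real lam)) =
      real v * (real v - 1) * (real b + 1)" .
  then have rl: "4 * (real r - real lam) = real b + 1"
    using v by simp
  have quarter: "c * (real r - real lam) / (real b + 1) = c / 4" for c
    using mult_divide_quarter[OF rl] by simp
  have "real x = (real v - 3 * w) / 4" "real y = (real v - w) / 4"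
    using R by (simp_all only: real_design_def)
  then have "real x = real k - (real v + w) * (real r - real lam) / (real b + 1)"
    "real y = real k - (real v - w) * (real r - real lam) / (real b + 1)"
    unfolding quarter using kw by argo+
  then have D: "etf_design v b X k lam r x y"
    using R k unfolding real_design_def etf_design_def by blast
  then show "etf_design v b X k lam r x y \<and> is_etf 1 (-2)"
    unfolding design_is_etf_iff[OF D] using kw rl by simp
next
  assume D: "etf_design v b X k lam r x y \<and> is_etf 1 (-2)"
  then have kw: "w = real v - 2 * real k" and rl: "4 * (real r - real lam) = real b + 1"
    using design_is_etf_iff[of k lam r x y 1 "-2"] by auto
  have quarter: "c * (real r - real lam) / (real b + 1) = c / 4" for c
    using mult_divide_quarter[OF rl] by simp
  have "real x = real k - (real v + w) / 4" "real y = real k - (real v - w) / 4"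
    unfolding quarter[symmetric] using D by (simp_all only: etf_design_def)
  then have "real k = (real v - w) / 2" "real x = (real v - 3 * w) / 4" "real y = (real v - w) / 4"
    using kw by argo+
  then show "real_design k lam r x y"
    using D unfolding real_design_def etf_design_def by blast
qed

lemma is_etf_1_iff: "is_etf 1 (-2) \<longleftrightarrow> (\<exists>k lam r x y. real_design k lam r x y)"
  unfolding real_design_iff using is_etf_imp_design by blast

text \<open>Eliminating w from the formulas for k, x and y gives k = 2 y and v = 3 k - 2 x, so v = 2
  (3 y - x) is even, and so is w = v - 2 k. The last claim is b + 1 = 4 (r - \<lambda>).\<close>

lemma is_etf_1_divisibility:
  assumes "is_etf 1 (-2)"
  shows "even v" "\<exists>m::int. w = of_int m \<and> even m" "4 dvd b + 1"
proof -
  obtain k lam r x y where R: "real_design k lam r x y"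
    using assms is_etf_1_iff by auto
  then have D: "etf_design v b X k lam r x y"
    by (simp add: real_design_iff)
  have w: "w = real v - 2 * real k" and "real k = 2 * real y" "real v = 3 * real k - 2 * real x"
    using R by (auto simp: real_design_def)
  then have k: "int k = 2 * int y" and vx: "int v = 3 * int k - 2 * int x"
    by linarith+
  have "int v = 2 * (3 * int y - int x)"
    using k vx by simp
  then have "even (int v)"
    by (metis dvd_triv_left)
  then show "even v"
    by simp
  show "\<exists>m::int. w = of_int m \<and> even m"
    using w \<open>even v\<close> by (intro exI[of _ "int v - 2 * int k"]) simp
  have "4 * (real r - real lam) = real b + 1"
    using design_is_etf_iff[OF D, of 1 "-2"] assms by simp
  \<comment> \<open>Divisibility is derived over the integers because subtraction of naturals
    truncates.\<close>
  then have "real_of_int (int (b + 1)) = real_of_int (4 * (int r - int lam))"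
    by simp
  then have "int (b + 1) = 4 * (int r - int lam)"
    by (simp only: of_int_eq_iff)
  then have "int 4 dvd int (b + 1)"
    by (metis dvd_triv_left of_nat_numeral)
  then show "4 dvd b + 1"
    by (simp only: of_nat_dvd_iff)
qed

end

section \<open>Signing a matrix\<close>

text \<open>The rows are signed by the first column, which turns that column into 1; then each
  column is signed by its inner product with 1. The matrix \<open>X\<close> marks the entries -1 of
  the remaining columns.\<close>

lemma sign_normalization:
  fixes \<Psi> :: "real mat"
  assumes M: "\<Psi> \<in> carrier_mat d n" and pm: "elements_mat \<Psi> \<subseteq> {1, -1}" and "0 < n"
  obtains s t :: "nat \<Rightarrow> real" and X :: "real mat"
  where "\<forall>i<d. s i \<in> {1, -1}" "\<forall>j<n. t j \<in> {1, -1}"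
    "X \<in> carrier_mat (n - 1) d" "elements_mat X \<subseteq> {0, 1}"
    "mat d n (\<lambda>(i, j). s i * t j * \<Psi> $$ (i, j)) = frame_mat d (n - 1) 1 (-2) X"
    "\<forall>j<n. col (mat d n (\<lambda>(i, j). s i * t j * \<Psi> $$ (i, j))) 0 \<bullet>
       col (mat d n (\<lambda>(i, j). s i * t j * \<Psi> $$ (i, j))) j \<ge> 0"
proof -
  have ent: "\<Psi> $$ (i, j) = 1 \<or> \<Psi> $$ (i, j) = -1" if "i < d" "j < n" for i j
    using that M pm elements_matI[of \<Psi> d n i j] by blast
  define s where "s = (\<lambda>i. \<Psi> $$ (i, 0))"
  \<comment> \<open>A vanishing inner product gets the sign 1. Column 0 has inner product d with
    itself, so \<open>t 0 = 1\<close> and it stays the all-ones column.\<close>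
  define t where "t = (\<lambda>j. if 0 \<le> (\<Sum>i<d. s i * \<Psi> $$ (i, j)) then 1 else -1 :: real)"
  define \<Phi> where "\<Phi> = mat d n (\<lambda>(i, j). s i * t j * \<Psi> $$ (i, j))"
  define X where "X = mat (n - 1) d (\<lambda>(j, i). (1 - \<Phi> $$ (i, Suc j)) / 2)"
  have s: "s i = 1 \<or> s i = -1" if "i < d" for i
    using ent[OF that \<open>0 < n\<close>] by (simp add: s_def)
  have t: "t j = 1 \<or> t j = -1" for j
    by (simp add: t_def)
  have ss: "s i * \<Psi> $$ (i, 0) = 1" if "i < d" for i
    using ent[OF that \<open>0 < n\<close>] by (auto simp: s_def)
  have t0: "t 0 = 1"
    by (simp add: t_def ss)
  have \<Phi>0: "\<Phi> $$ (i, 0) = 1" if "i < d" for i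
    using that \<open>0 < n\<close> ss by (simp add: \<Phi>_def t0)
  have \<Phi>_pm: "\<Phi> $$ (i, j) = 1 \<or> \<Phi> $$ (i, j) = -1" if "i < d" "j < n" for i j
    using that s[OF that(1)] t[of j] ent[OF that] by (auto simp: \<Phi>_def)
  have X: "X \<in> carrier_mat (n - 1) d"
    by (simp add: X_def)
  have "elements_mat X \<subseteq> {0, 1}"
  proof
    fix a assume "a \<in> elements_mat X"
    then obtain j i where "j < n - 1" "i < d" "a = X $$ (j, i)"
      using elements_matD[of a X] X by auto
    then show "a \<in> {0, 1}"
      using \<Phi>_pm[of i "Suc j"] by (auto simp: X_def)
  qed
  moreover have "\<Phi> = frame_mat d (n - 1) 1 (-2) X"
  proof (rule eq_matI)
    show "dim_row \<Phi> = dim_row (frame_mat d (n - 1) 1 (-2) X)"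
      "dim_col \<Phi> = dim_col (frame_mat d (n - 1) 1 (-2) X)"
      using frame_mat_carrier[OF X, of 1 "-2"] \<open>0 < n\<close> by (auto simp: \<Phi>_def)
    fix i j assume "i < dim_row (frame_mat d (n - 1) 1 (-2) X)" "j < dim_col (frame_mat d (n - 1) 1 (-2) X)"
    then have "i < d" "j < n"
      using frame_mat_carrier[OF X, of 1 "-2"] \<open>0 < n\<close> by auto
    then show "\<Phi> $$ (i, j) = frame_mat d (n - 1) 1 (-2) X $$ (i, j)"
      using X \<Phi>0 by (cases j) (auto simp: X_def field_simps)
  qed
  moreover have "col \<Phi> 0 \<bullet> col \<Phi> j \<ge> 0" if "j < n" for j
  proof -
    have "col \<Phi> 0 \<bullet> col \<Phi> j = (\<Sum>i<d. \<Phi> $$ (i, j))"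
      using that \<open>0 < n\<close> \<Phi>0 by (simp add: scalar_prod_def lessThan_atLeast0 \<Phi>_def)
    also have "\<dots> = t j * (\<Sum>i<d. s i * \<Psi> $$ (i, j))"
      using that by (simp add: \<Phi>_def sum_distrib_left mult_ac)
    also have "\<dots> \<ge> 0"
      by (simp add: t_def)
    finally show ?thesis .
  qed
  ultimately show thesis
    using that[of s t X] s t X unfolding \<Phi>_def by auto
qed

theorem theorem3:
  shows
    "(\<forall>(v::nat) (b::nat) (X::real mat).
        1 < v \<and> v < b \<and> X \<in> carrier_mat b v \<and> elements_mat X \<subseteq> {0, 1} \<longrightarrow>
        (let w = sqrt (real v * (real b + 1 - real v) / real b);
             good = (\<lambda>\<delta> \<epsilon>. let \<phi> = col (frame_mat v b \<delta> \<epsilon> X) in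
                       equiangular_tight_frame v (b + 1) \<phi> \<and> (\<forall>j<b + 1. \<phi> 0 \<bullet> \<phi> j > 0));
             qsd = (\<lambda>k lam r x y.
                       QSD_incidence_mat X v k lam r b x y \<and> 0 < k \<and> k < v \<and>
                       real r = real b * real k / real v \<and>
                       real lam = real r * (real k - 1) / (real v - 1) \<and>
                       real x = real k - (real v + w) * (real r - real lam) / (real b + 1) \<and>
                       real y = real k - (real v - w) * (real r - real lam) / (real b + 1))
         in ((\<exists>\<delta> \<epsilon>. good \<delta> \<epsilon>) \<longleftrightarrow> (\<exists>k lam r x y. qsd k lam r x y)) \<and>
            (\<forall>k lam r x y. qsd k lam r x y \<longrightarrow>
               (let s = sqrt ((real b + 1) / (real r - real lam))
                in {(\<delta>, \<epsilon>). good \<delta> \<epsilon>} =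
                     {((w + real k * s) / real v, - s), ((w - real k * s) / real v, s)} \<and>
                   card {(\<delta>, \<epsilon>). good \<delta> \<epsilon>} = 2 \<and>
                   (\<forall>\<delta> \<epsilon>. good \<delta> \<epsilon> \<longrightarrow> \<epsilon> = (w - \<delta> * real v) / real k)))))
     \<and>
     (\<forall>(d::nat) (n::nat). 1 < d \<and> d < n - 1 \<longrightarrow>
        (\<forall>(\<Psi>::real mat). \<Psi> \<in> carrier_mat d n \<and> elements_mat \<Psi> \<subseteq> {1, -1} \<longrightarrow>
           (\<exists>(s::nat \<Rightarrow> real) (t::nat \<Rightarrow> real) (X::real mat).
              (\<forall>i<d. s i \<in> {1, -1}) \<and> (\<forall>j<n. t j \<in> {1, -1}) \<and>
              X \<in> carrier_mat (n - 1) d \<and> elements_mat X \<subseteq> {0, 1} \<and>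
              (let \<Phi> = mat d n (\<lambda>(i, j). s i * t j * \<Psi> $$ (i, j))
               in \<Phi> = frame_mat d (n - 1) 1 (-2) X \<and>
                  (\<forall>j<n. col \<Phi> 0 \<bullet> col \<Phi> j \<ge> 0) \<and>
                  (equiangular_tight_frame d n (col \<Psi>) \<longleftrightarrow>
                   equiangular_tight_frame d n (col \<Phi>))))) \<and>
        (\<forall>(\<Phi>::real mat) (X::real mat).
           \<Phi> \<in> carrier_mat d n \<and> elements_mat \<Phi> \<subseteq> {1, -1} \<and>
           X \<in> carrier_mat (n - 1) d \<and> elements_mat X \<subseteq> {0, 1} \<and>
           \<Phi> = frame_mat d (n - 1) 1 (-2) X \<and>
           (\<forall>j<n. col \<Phi> 0 \<bullet> col \<Phi> j \<ge> 0) \<longrightarrow>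
           (let v = d; b = n - 1;
                w = sqrt (real v * (real b + 1 - real v) / real b)
            in (equiangular_tight_frame d n (col \<Phi>) \<longleftrightarrow>
                (\<exists>k lam r x y. QSD_incidence_mat X v k lam r b x y \<and>
                   real k = (real v - w) / 2 \<and>
                   real r = real b * real k / real v \<and>
                   real lam = real r * (real k - 1) / (real v - 1) \<and>
                   real x = (real v - 3 * w) / 4 \<and>
                   real y = (real v - w) / 4)) \<and>
               (equiangular_tight_frame d n (col \<Phi>) \<longrightarrow>
                even d \<and> (\<exists>m::int. w = of_int m \<and> even m) \<and> 4 dvd n))))"
proof (intro conjI allI impI)
  fix v b :: nat and X :: "real mat"
  assume A: "1 < v \<and> v < b \<and> X \<in> carrier_mat b v \<and> elements_mat X \<subseteq> {0, 1}"
  then interpret zero_one_mat X v b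
    by unfold_locales auto
  have good: "equiangular_tight_frame v (b + 1) (col (frame_mat v b \<delta> \<epsilon> X)) \<and>
      (\<forall>j<b + 1. 0 < col (frame_mat v b \<delta> \<epsilon> X) 0 \<bullet> col (frame_mat v b \<delta> \<epsilon> X) j) \<longleftrightarrow>
      is_etf \<delta> \<epsilon>" for \<delta> \<epsilon>
    using A by (intro etf_frame_mat_pos_iff) auto
  have exist: "(\<exists>\<delta> \<epsilon>. is_etf \<delta> \<epsilon>) \<longleftrightarrow> (\<exists>k lam r x y. etf_design v b X k lam r x y)"
  proof
    assume "\<exists>k lam r x y. etf_design v b X k lam r x y"
    then obtain k lam r x y where "etf_design v b X k lam r x y" by blast
    \<comment> \<open>The solution set is an explicit pair of points, hence not empty.\<close>
    from design_etf_parameters(1)[OF this] show "\<exists>\<delta> \<epsilon>. is_etf \<delta> \<epsilon>"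
      by blast
  qed (use is_etf_imp_design in blast)
  show "let w = sqrt (real v * (real b + 1 - real v) / real b);
             good = (\<lambda>\<delta> \<epsilon>. let \<phi> = col (frame_mat v b \<delta> \<epsilon> X) in
                       equiangular_tight_frame v (b + 1) \<phi> \<and> (\<forall>j<b + 1. \<phi> 0 \<bullet> \<phi> j > 0));
             qsd = (\<lambda>k lam r x y.
                       QSD_incidence_mat X v k lam r b x y \<and> 0 < k \<and> k < v \<and>
                       real r = real b * real k / real v \<and>
                       real lam = real r * (real k - 1) / (real v - 1) \<and>
                       real x = real k - (real v + w) * (real r - real lam) / (real b + 1) \<and>
                       real y = real k - (real v - w) * (real r - real lam) / (real b + 1))
         in ((\<exists>\<delta> \<epsilon>. good \<delta> \<epsilon>) \<longleftrightarrow> (\<exists>k lam r x y. qsd k lam r x y)) \<and>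
            (\<forall>k lam r x y. qsd k lam r x y \<longrightarrow>
               (let s = sqrt ((real b + 1) / (real r - real lam))
                in {(\<delta>, \<epsilon>). good \<delta> \<epsilon>} =
                     {((w + real k * s) / real v, - s), ((w - real k * s) / real v, s)} \<and>
                   card {(\<delta>, \<epsilon>). good \<delta> \<epsilon>} = 2 \<and>
                   (\<forall>\<delta> \<epsilon>. good \<delta> \<epsilon> \<longrightarrow> \<epsilon> = (w - \<delta> * real v) / real k)))"
    unfolding Let_def good welch_def[symmetric] etf_design_def[symmetric]
    using exist design_etf_parameters by (intro conjI allI impI)
next
  fix d n :: nat and \<Psi> :: "real mat"
  assume dn: "1 < d \<and> d < n - 1" and \<Psi>: "\<Psi> \<in> carrier_mat d n \<and> elements_mat \<Psi> \<subseteq> {1, -1}"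
  have "0 < n"
    using dn by linarith
  obtain s t :: "nat \<Rightarrow> real" and X :: "real mat"
    where st: "\<forall>i<d. s i \<in> {1, -1}" "\<forall>j<n. t j \<in> {1, -1}"
    and *: "X \<in> carrier_mat (n - 1) d" "elements_mat X \<subseteq> {0, 1}"
      "mat d n (\<lambda>(i, j). s i * t j * \<Psi> $$ (i, j)) = frame_mat d (n - 1) 1 (-2) X"
      "\<forall>j<n. col (mat d n (\<lambda>(i, j). s i * t j * \<Psi> $$ (i, j))) 0 \<bullet>
         col (mat d n (\<lambda>(i, j). s i * t j * \<Psi> $$ (i, j))) j \<ge> 0"
    using sign_normalization[OF conjunct1[OF \<Psi>] conjunct2[OF \<Psi>] \<open>0 < n\<close>] by blast
  have "equiangular_tight_frame d n (col \<Psi>) \<longleftrightarrow>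
      equiangular_tight_frame d n (col (mat d n (\<lambda>(i, j). s i * t j * \<Psi> $$ (i, j))))"
    using etf_sign_mat_iff[of \<Psi> d n s t] \<Psi> st by simp
  with st * show "\<exists>(s::nat \<Rightarrow> real) (t::nat \<Rightarrow> real) (X::real mat).
              (\<forall>i<d. s i \<in> {1, -1}) \<and> (\<forall>j<n. t j \<in> {1, -1}) \<and>
              X \<in> carrier_mat (n - 1) d \<and> elements_mat X \<subseteq> {0, 1} \<and>
              (let \<Phi> = mat d n (\<lambda>(i, j). s i * t j * \<Psi> $$ (i, j))
               in \<Phi> = frame_mat d (n - 1) 1 (-2) X \<and>
                  (\<forall>j<n. col \<Phi> 0 \<bullet> col \<Phi> j \<ge> 0) \<and>
                  (equiangular_tight_frame d n (col \<Psi>) \<longleftrightarrow>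
                   equiangular_tight_frame d n (col \<Phi>)))"
    unfolding Let_def by blast
next
  fix d n :: nat and \<Phi> X :: "real mat"
  assume dn: "1 < d \<and> d < n - 1"
    and A: "\<Phi> \<in> carrier_mat d n \<and> elements_mat \<Phi> \<subseteq> {1, -1} \<and>
           X \<in> carrier_mat (n - 1) d \<and> elements_mat X \<subseteq> {0, 1} \<and>
           \<Phi> = frame_mat d (n - 1) 1 (-2) X \<and>
           (\<forall>j<n. col \<Phi> 0 \<bullet> col \<Phi> j \<ge> 0)"
  interpret zero_one_mat X d "n - 1"
    using dn A by unfold_locales auto
  have n: "n - 1 + 1 = n"
    using dn by linarith
  have \<Phi>: "\<Phi> = frame_mat d (n - 1) 1 (-2) X" and "\<forall>j<n. 0 \<le> col \<Phi> 0 \<bullet> col \<Phi> j" and "0 < d"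
    using dn A by auto
  \<comment> \<open>Nonnegativity is a hypothesis here, not part of the property to be
    characterized, so the criterion with the weak sign condition applies.\<close>
  then have "equiangular_tight_frame d n (col \<Phi>) \<longleftrightarrow> is_etf 1 (-2)"
    using etf_frame_mat_nonneg_iff[OF X \<open>0 < d\<close> v(2), of 1 "-2", folded \<Phi>, unfolded n] by blast
  then show "let v = d; b = n - 1;
                w = sqrt (real v * (real b + 1 - real v) / real b)
            in (equiangular_tight_frame d n (col \<Phi>) \<longleftrightarrow>
                (\<exists>k lam r x y. QSD_incidence_mat X v k lam r b x y \<and>
                   real k = (real v - w) / 2 \<and>
                   real r = real b * real k / real v \<and>
                   real lam = real r * (real k - 1) / (real v - 1) \<and>
                   real x = (real v - 3 * w) / 4 \<and>
                   real y = (real v - w) / 4)) \<and>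
               (equiangular_tight_frame d n (col \<Phi>) \<longrightarrow>
                even d \<and> (\<exists>m::int. w = of_int m \<and> even m) \<and> 4 dvd n)"
    using is_etf_1_divisibility[unfolded n]
    unfolding Let_def welch_def[symmetric] real_design_def[symmetric] is_etf_1_iff[symmetric]
    by blast
qed

end
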